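(* Let $P:\mathbb{R}^N\to\mathbb{R}^N$ be $C^1$, let $S$ be an open, $(N-1)$-dimensional hypersurface embedded in $\mathbb{R}^N$ that is non-recurrent with respect to $P$, let $\Omega(S)\subset\mathbb{R}^N$ be the set of all points on the solution orbits of $\dot{\bm{x}}=P(\bm{x})$ intersecting $S$, and let $m$ be the unit measurement on $\Omega(S)$ vanishing on $S$. Then there exist $N-1$ invariant functions $h_i:\Omega(S)\to(0,1)$, $i=1,\dots,N-1$, such that any Koopman eigenfunction defined on $\Omega(S)$, with eigenvalue $\lambda$, is of the form $$\Phi(\bm{x})=f\big(h_1(\bm{x}),\dots,h_{N-1}(\bm{x})\big)\,e^{\lambda m(\bm{x})},$$ where $f$ is any differentiable function on $(0,1)^{N-1}$.
   Context: The dynamical system is $\dot{\bm{x}}=P(\bm{x})$ with $P:\mathbb{R}^N\to\mathbb{R}^N$ of class $C^1$. Non-recurrent: $S$ is non-recurrent with respect to $P$ if any solution orbit of $P$ intersects $S$ at most once (a periodic orbit that returns to a point of $S$ is regarded as violating this). Unit measurement $m$: the unique solution on $\Omega(S)$ of $\nabla m(\bm{x})^T P(\bm{x})=1$ satisfying $m\equiv 0$ on $S$. Its existence and uniqueness on $\Omega(S)$ are obtained from the method of characteristics for the Cauchy problem, using that $S$ is non-recurrent. Invariant function: a function $h$ on $\Omega(S)$ with $\nabla h(\bm{x})^T P(\bm{x})=0$ for all $\bm{x}\in\Omega(S)$. Koopman eigenfunction on $\Omega(S)$ with eigenvalue $\lambda\in\mathbb{C}$: a $C^1$ complex-valued function $\Phi$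 on $\Omega(S)$ satisfying the Koopman partial differential equation $\nabla\Phi(\bm{x})^T P(\bm{x})=\lambda\Phi(\bm{x})$ for all $\bm{x}\in\Omega(S)$.
   Formalization: S is taken to be a C¹ embedded image of the open cube (0,1)^{N-1} (the claim fails, e.g., for a punctured torus in R³); eigenfunctions correspond exactly to C¹ f, while a merely differentiable f is shown only to give a differentiable solution of the Koopman equation. *)

theory Defs
  imports "HOL-Analysis.Analysis"
begin

definition C1_on :: "('a::real_normed_vector \<Rightarrow> 'b::real_normed_vector) \<Rightarrow> 'a set \<Rightarrow> bool" where
  "C1_on f A \<longleftrightarrow>
     (\<exists>f'. (\<forall>x\<in>A. (f has_derivative blinfun_apply (f' x)) (at x within A)) \<and> continuous_on A f')"

text \<open>
  The cube \<open>(0,1)\<^sup>N\<^sup>-\<^sup>1\<close> is realised inside the coordinate hyperplane \<open>u $ p = 0\<close> of \<open>\<real>\<^sup>N\<close>, for an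
  arbitrary index \<open>p\<close>; the remaining \<open>N - 1\<close> indices \<open>i \<noteq> p\<close> number its coordinates. In this way
  \<open>N = 1\<close> is covered (the cube is then a point), which an index type with \<open>N - 1\<close> elements would
  exclude. The cube is open in the hyperplane, so differentiability and \<open>C\<^sup>1\<close> relative to this set
  are the usual notions in the \<open>N - 1\<close> coordinates.
\<close>

definition open_cube :: "'n::finite \<Rightarrow> (real ^ 'n) set" where
  "open_cube p = {u. u $ p = 0 \<and> (\<forall>i. i \<noteq> p \<longrightarrow> 0 < u $ i \<and> u $ i < 1)}"

text \<open>
  An open \<open>(N-1)\<close>-dimensional hypersurface embedded in \<open>\<real>\<^sup>N\<close> is the image of a \<open>C\<^sup>1\<close> embedding (an
  immersion that is a homeomorphism onto its image) of the open \<open>(N-1)\<close>-cube. Hypersurfaces without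
  such a global parametrisation (for instance a punctured torus) do not admit \<open>N - 1\<close> real
  coordinates, and functions on them do not all factor through \<open>(0,1)\<^sup>N\<^sup>-\<^sup>1\<close>. Injectivity of the
  derivative is required on the hyperplane \<open>v $ p = 0\<close> only: values in direction \<open>p\<close> are not
  determined by \<open>\<sigma>\<close> on the cube.
\<close>

definition embedded_open_hypersurface :: "'n::finite \<Rightarrow> (real ^ 'n) set \<Rightarrow> bool" where
  "embedded_open_hypersurface p S \<longleftrightarrow>
     (\<exists>\<sigma> \<sigma>'. (\<forall>u\<in>open_cube p.
               (\<sigma> has_derivative blinfun_apply (\<sigma>' u)) (at u within open_cube p) \<and>
               (\<forall>v. v $ p = 0 \<and> blinfun_apply (\<sigma>' u) v = 0 \<longrightarrow> v = 0)) \<and>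
            continuous_on (open_cube p) \<sigma>' \<and>
            (\<exists>\<tau>. homeomorphism (open_cube p) S \<sigma> \<tau>))"

text \<open>Solutions live on open time intervals, since \<open>P\<close> need not be complete.\<close>

definition ode_solution ::
    "('a::real_normed_vector \<Rightarrow> 'a) \<Rightarrow> real set \<Rightarrow> (real \<Rightarrow> 'a) \<Rightarrow> bool" where
  "ode_solution P I x \<longleftrightarrow>
     open I \<and> is_interval I \<and> (\<forall>t\<in>I. (x has_vector_derivative P (x t)) (at t))"

definition orbit_domain :: "('a::real_normed_vector \<Rightarrow> 'a) \<Rightarrow> 'a set \<Rightarrow> 'a set" where
  "orbit_domain P S =
     {y. \<exists>I x. ode_solution P I x \<and> (\<exists>t\<in>I. x t = y) \<and> (\<exists>s\<in>I. x s \<in> S)}"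

text \<open>
  Intersections are counted in time, so a periodic orbit (or an equilibrium) meeting \<open>S\<close> violates
  non-recurrence.
\<close>

definition non_recurrent :: "('a::real_normed_vector \<Rightarrow> 'a) \<Rightarrow> 'a set \<Rightarrow> bool" where
  "non_recurrent P S \<longleftrightarrow>
     (\<forall>I x. ode_solution P I x \<longrightarrow> (\<forall>s\<in>I. \<forall>t\<in>I. x s \<in> S \<and> x t \<in> S \<longrightarrow> s = t))"

text \<open>The equation \<open>\<nabla>u(x)\<^sup>T P(x) = g(x)\<close> on \<open>\<Omega>\<close>, for differentiable \<open>u\<close>.\<close>

definition gradient_eq ::
    "('a::real_normed_vector \<Rightarrow> 'a) \<Rightarrow> 'a set \<Rightarrow> ('a \<Rightarrow> 'b::real_normed_vector) \<Rightarrow> ('a \<Rightarrow> 'b) \<Rightarrow> bool" where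
  "gradient_eq P \<Omega> u g \<longleftrightarrow>
     (\<forall>x\<in>\<Omega>. \<exists>D. (u has_derivative D) (at x within \<Omega>) \<and> D (P x) = g x)"

definition unit_measurement ::
    "('a::real_normed_vector \<Rightarrow> 'a) \<Rightarrow> 'a set \<Rightarrow> ('a \<Rightarrow> real) \<Rightarrow> bool" where
  "unit_measurement P S m \<longleftrightarrow>
     gradient_eq P (orbit_domain P S) m (\<lambda>x. 1) \<and> (\<forall>x\<in>S. m x = 0)"

definition invariant_function ::
    "('a::real_normed_vector \<Rightarrow> 'a) \<Rightarrow> 'a set \<Rightarrow> ('a \<Rightarrow> real) \<Rightarrow> bool" where
  "invariant_function P \<Omega> h \<longleftrightarrow> gradient_eq P \<Omega> h (\<lambda>x. 0)"

definition koopman_eigenfunction ::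
    "('a::real_normed_vector \<Rightarrow> 'a) \<Rightarrow> 'a set \<Rightarrow> complex \<Rightarrow> ('a \<Rightarrow> complex) \<Rightarrow> bool" where
  "koopman_eigenfunction P \<Omega> \<mu> \<Phi> \<longleftrightarrow>
     C1_on \<Phi> \<Omega> \<and> gradient_eq P \<Omega> \<Phi> (\<lambda>x. \<mu> * \<Phi> x)"

text \<open>The point \<open>(h\<^sub>1(x), \<dots>, h\<^sub>N\<^sub>-\<^sub>1(x))\<close> of the hyperplane \<open>u $ p = 0\<close>.\<close>

definition tuple_at :: "'n::finite \<Rightarrow> ('n \<Rightarrow> 'a \<Rightarrow> real) \<Rightarrow> 'a \<Rightarrow> real ^ 'n" where
  "tuple_at p h x = (\<chi> i. if i = p then 0 else h i x)"

end

theory Submission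
  imports Defs
begin

text \<open>
  Every orbit in \<open>\<Omega>\<close>, the domain swept out by the orbits through \<open>S\<close>, crosses \<open>S\<close> exactly once. A point \<open>y\<close> of
  \<open>\<Omega>\<close> is therefore determined by the crossing point \<open>\<sigma> u\<close> of its orbit, with \<open>u\<close> in the cube, and by the
  time \<open>t\<close> needed to travel from there to \<open>y\<close>. The coordinates \<open>(u, t)\<close> straighten the flow: along an orbit \<open>u\<close>
  is constant and \<open>t\<close> grows at unit speed. So the components of \<open>u\<close> are invariant functions with values in
  \<open>(0,1)\<close>, and \<open>t\<close> is the unit measurement \<open>m\<close>. Along an orbit the Koopman equation is the scalar linear equation
  \<open>g' = \<mu> * g\<close>, whence \<open>\<Phi> y = \<Phi> (\<sigma> u) * exp (\<mu> * m y)\<close>, and \<open>f = \<Phi> \<circ> \<sigma>\<close> is the required function on the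
  cube. The converse is the chain rule, because \<open>(u, t)\<close> has derivative \<open>(0, 1)\<close> in the direction \<open>P\<close>.

  The substance is that \<open>(u, t)\<close> is a \<open>C\<^sup>1\<close> map on an open set (\<open>chart_C1\<close>, \<open>open_domain\<close>). Since \<open>m\<close>
  vanishes on \<open>S\<close> but grows at rate one along \<open>P\<close>, the field is transversal to \<open>S\<close> (\<open>transversal\<close>).
  Hence \<open>(u, t) \<mapsto> \<phi> t (\<sigma> u)\<close>, where \<open>\<phi>\<close> is a local flow, has an invertible derivative at time zero, and the
  inverse function theorem gives regularity near \<open>S\<close> (\<open>straightened_section\<close>). The short-time flow maps carry the
  regularity along each orbit, and connectedness of the time interval makes it reach every point
  (\<open>straightened_reaches\<close>).

  Both steps need local flows that depend on the initial point in a \<open>C\<^sup>1\<close> way (\<open>local_flow\<close>). Hadamard's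
  quotient writes \<open>P b - P a = Q a b (b - a)\<close> with \<open>Q\<close> continuous, so the difference of two solutions solves a
  \<^emph>\<open>linear\<close> equation whose coefficients depend continuously on the two initial points. Its solution operator
  \<open>\<Psi> t x y\<close> is then continuous in all arguments and satisfies \<open>\<phi> t y - \<phi> t x = \<Psi> t x y (y - x)\<close>,
  which exhibits \<open>\<Psi> t x x\<close> as the derivative of \<open>\<phi> t\<close> at \<open>x\<close>. One contraction argument with
  parameters (\<open>parametric_picard\<close>) yields both \<open>\<phi>\<close> and \<open>\<Psi>\<close>.
\<close>

section \<open>Calculus of \<open>C\<^sup>1\<close> maps\<close>

lemma C1_on_imp_continuous_on: "C1_on f A \<Longrightarrow> continuous_on A f"
  unfolding C1_on_def by (meson continuous_on_eq_continuous_within has_derivative_continuous)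

lemma C1_on_subset: "C1_on f B \<Longrightarrow> A \<subseteq> B \<Longrightarrow> C1_on f A"
  unfolding C1_on_def by (meson continuous_on_subset has_derivative_subset subsetD)

lemma C1_on_cong:
  assumes "C1_on f A" and eq: "\<And>x. x \<in> A \<Longrightarrow> g x = f x"
  shows "C1_on g A"
proof -
  obtain f' where f': "\<And>x. x \<in> A \<Longrightarrow> (f has_derivative blinfun_apply (f' x)) (at x within A)"
      "continuous_on A f'"
    using assms(1) by (auto simp: C1_on_def)
  have "\<forall>x\<in>A. (g has_derivative blinfun_apply (f' x)) (at x within A)"
    using has_derivative_transform[OF _ eq f'(1)] by simp
  then show ?thesis using f'(2) by (auto simp: C1_on_def)
qed

lemma C1_on_compose:
  assumes f: "C1_on f A" and g: "C1_on g B" and sub: "f ` A \<subseteq> B"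
  shows "C1_on (\<lambda>x. g (f x)) A"
proof -
  obtain f' where f': "\<And>x. x \<in> A \<Longrightarrow> (f has_derivative blinfun_apply (f' x)) (at x within A)"
      "continuous_on A f'"
    using f by (auto simp: C1_on_def)
  obtain g' where g': "\<And>x. x \<in> B \<Longrightarrow> (g has_derivative blinfun_apply (g' x)) (at x within B)"
      "continuous_on B g'"
    using g by (auto simp: C1_on_def)
  have "((\<lambda>x. g (f x)) has_derivative blinfun_apply (g' (f x) o\<^sub>L f' x)) (at x within A)"
    if "x \<in> A" for x
    using has_derivative_in_compose[OF f'(1)[OF that] has_derivative_subset[OF g'(1) sub]] sub that
    by (auto simp: blinfun_compose.rep_eq o_def)
  moreover have "continuous_on A (\<lambda>x. g' (f x) o\<^sub>L f' x)"
    by (intro continuous_intros continuous_on_compose2[OF g'(2) C1_on_imp_continuous_on[OF f] sub] f')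
  ultimately show ?thesis
    unfolding C1_on_def by (intro exI[of _ "\<lambda>x. g' (f x) o\<^sub>L f' x"]) auto
qed

lemma C1_on_affine:
  assumes "bounded_linear f"
  shows "C1_on (\<lambda>x. c + f x) A"
  unfolding C1_on_def
  by (intro exI[of _ "\<lambda>_. Blinfun f"])
    (auto simp: bounded_linear_Blinfun_apply[OF assms] intro!: derivative_eq_intros bounded_linear_imp_has_derivative assms)

lemma C1_on_Pair:
  assumes f: "C1_on f A" and g: "C1_on g A"
  shows "C1_on (\<lambda>x. (f x, g x)) A"
proof -
  obtain f' where f': "\<And>x. x \<in> A \<Longrightarrow> (f has_derivative blinfun_apply (f' x)) (at x within A)"
      "continuous_on A f'"
    using f by (auto simp: C1_on_def)
  obtain g' where g': "\<And>x. x \<in> A \<Longrightarrow> (g has_derivative blinfun_apply (g' x)) (at x within A)"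
      "continuous_on A g'"
    using g by (auto simp: C1_on_def)
  define inl where "inl = Blinfun (\<lambda>x::'b. (x, 0::'c))"
  define inr where "inr = Blinfun (\<lambda>x::'c. (0::'b, x))"
  have inl: "blinfun_apply inl = (\<lambda>x. (x, 0))" and inr: "blinfun_apply inr = (\<lambda>x. (0, x))"
    unfolding inl_def inr_def
    by (intro bounded_linear_Blinfun_apply bounded_linear_Pair bounded_linear_ident bounded_linear_zero)+
  define D where "D = (\<lambda>x. (inl o\<^sub>L f' x) + (inr o\<^sub>L g' x))"
  have "((\<lambda>x. (f x, g x)) has_derivative blinfun_apply (D x)) (at x within A)" if "x \<in> A" for x
    using has_derivative_Pair[OF f'(1)[OF that] g'(1)[OF that]]
    by (simp add: D_def blinfun.add_left[abs_def] inl inr)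
  moreover have "continuous_on A D"
    unfolding D_def using f'(2) g'(2) by (intro continuous_intros)
  ultimately show ?thesis unfolding C1_on_def by blast
qed

lemma C1_on_mult:
  fixes f g :: "'a::real_normed_vector \<Rightarrow> 'b::real_normed_algebra"
  assumes f: "C1_on f A" and g: "C1_on g A"
  shows "C1_on (\<lambda>x. f x * g x) A"
proof -
  obtain f' where f': "\<And>x. x \<in> A \<Longrightarrow> (f has_derivative blinfun_apply (f' x)) (at x within A)"
      "continuous_on A f'"
    using f by (auto simp: C1_on_def)
  obtain g' where g': "\<And>x. x \<in> A \<Longrightarrow> (g has_derivative blinfun_apply (g' x)) (at x within A)"
      "continuous_on A g'"
    using g by (auto simp: C1_on_def)
  define D where "D = (\<lambda>x. (blinfun_mult_right (f x) o\<^sub>L g' x) + (blinfun_mult_left (g x) o\<^sub>L f' x))"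
  have "((\<lambda>x. f x * g x) has_derivative blinfun_apply (D x)) (at x within A)" if "x \<in> A" for x
    using has_derivative_mult[OF f'(1)[OF that] g'(1)[OF that]]
    by (simp add: D_def blinfun.add_left[abs_def] blinfun_mult_right.rep_eq)
  moreover have "continuous_on A D"
    unfolding D_def using C1_on_imp_continuous_on[OF f] C1_on_imp_continuous_on[OF g] f'(2) g'(2)
    by (intro continuous_intros
        bounded_linear.continuous_on[OF bounded_linear_blinfun_mult_right]
        bounded_linear.continuous_on[OF bounded_linear_blinfun_mult_left])
  ultimately show ?thesis unfolding C1_on_def by blast
qed

lemma C1_on_exp: "C1_on (exp :: 'b::{banach, real_normed_field} \<Rightarrow> 'b) A"
proof -
  have "(exp has_derivative blinfun_apply (blinfun_mult_right (exp x))) (at x within A)" for x :: 'b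
    using DERIV_exp[of x] by (simp add: has_field_derivative_def blinfun_mult_right.rep_eq has_derivative_at_withinI)
  moreover have "continuous_on A (\<lambda>x :: 'b. blinfun_mult_right (exp x))"
    by (intro bounded_linear.continuous_on[OF bounded_linear_blinfun_mult_right] continuous_intros)
  ultimately show ?thesis
    unfolding C1_on_def by (intro exI[of _ "\<lambda>x. blinfun_mult_right (exp x)"]) auto
qed

text \<open>
  Derivatives at interior points are unique, so the local choices of a derivative agree and form one continuous map.
\<close>

lemma C1_on_locally:
  assumes "\<And>x. x \<in> A \<Longrightarrow> \<exists>U. open U \<and> x \<in> U \<and> C1_on f U"
  shows "C1_on f A"
proof -
  define f' where "f' x = (SOME d. (f has_derivative blinfun_apply d) (at x))" for x
  have loc: "(f has_derivative blinfun_apply (f' x)) (at x)" "isCont f' x" if x: "x \<in> A" for x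
  proof -
    obtain U d where U: "open U" "x \<in> U" "\<And>y. y \<in> U \<Longrightarrow> (f has_derivative blinfun_apply (d y)) (at y)"
        "continuous_on U d"
      using assms[OF x] unfolding C1_on_def by (metis at_within_open)
    have f'_eq: "f' y = d y" if "y \<in> U" for y
    proof -
      have "(f has_derivative blinfun_apply (f' y)) (at y)"
        unfolding f'_def using U(3)[OF that] by (rule someI)
      with U(3)[OF that] show ?thesis
        using has_derivative_unique by (metis blinfun_eqI)
    qed
    show "(f has_derivative blinfun_apply (f' x)) (at x)" using U f'_eq by auto
    have "continuous_on U f'" using U(4) f'_eq by (metis continuous_on_cong)
    then show "isCont f' x" using U continuous_on_eq_continuous_at by blast
  qed
  then have "\<forall>x\<in>A. (f has_derivative blinfun_apply (f' x)) (at x within A)"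
    using has_derivative_at_withinI by blast
  moreover have "continuous_on A f'"
    using loc continuous_at_imp_continuous_on by blast
  ultimately show ?thesis unfolding C1_on_def by blast
qed

text \<open>
  The identity \<open>B y - B y0 = B y \<circ> (A y0 - A y) \<circ> B y0\<close> first bounds \<open>norm (B y)\<close> near \<open>y0\<close>
  and then makes the difference tend to zero.
\<close>

lemma continuous_on_blinfun_inverse:
  fixes A B :: "'x::topological_space \<Rightarrow> 'a::real_normed_vector \<Rightarrow>\<^sub>L 'a"
  assumes A: "continuous_on V A"
    and BA: "\<And>y v. y \<in> V \<Longrightarrow> B y (A y v) = v"
    and AB: "\<And>y v. y \<in> V \<Longrightarrow> A y (B y v) = v"
  shows "continuous_on V B"
  unfolding continuous_on
proof
  fix y0 assume y0: "y0 \<in> V"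
  define \<beta> where "\<beta> = norm (B y0) + 1"
  have \<beta>: "0 < \<beta>" "norm (B y0) \<le> \<beta>" by (auto simp: \<beta>_def add_nonneg_pos)
  have diff: "B y - B y0 = B y o\<^sub>L ((A y0 - A y) o\<^sub>L B y0)" if "y \<in> V" for y
    by (rule blinfun_eqI) (simp add: blinfun.bilinear_simps BA[OF that] AB[OF y0])
  have lim: "((\<lambda>y. norm (A y0 - A y)) \<longlongrightarrow> 0) (at y0 within V)"
  proof -
    have "(A \<longlongrightarrow> A y0) (at y0 within V)" using A y0 unfolding continuous_on by blast
    from tendsto_norm_zero[OF LIM_zero[OF this]] show ?thesis by (simp add: norm_minus_commute)
  qed
  have ev: "\<forall>\<^sub>F y in at y0 within V. y \<in> V \<and> norm (A y0 - A y) < 1 / (2 * \<beta>)"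
    using order_tendstoD(2)[OF lim, of "1 / (2 * \<beta>)"] \<beta>
    by (auto simp: eventually_conj_iff eventually_at_filter)
  have bound: "norm (B y - B y0) \<le> 2 * \<beta> * \<beta> * norm (A y0 - A y)"
    if y: "y \<in> V" "norm (A y0 - A y) < 1 / (2 * \<beta>)" for y
  proof -
    have 1: "norm (B y - B y0) \<le> norm (B y) * (norm (A y0 - A y) * \<beta>)"
      unfolding diff[OF y(1)]
      by (intro order_trans[OF norm_blinfun_compose] mult_left_mono order_trans[OF norm_blinfun_compose] \<beta>) auto
    also have "\<dots> \<le> norm (B y) * (1/2)"
      using y(2) \<beta>(1) by (intro mult_left_mono) (auto simp: field_simps)
    finally have "norm (B y) \<le> 2 * \<beta>"
      using norm_triangle_sub[of "B y" "B y0"] \<beta>(2) by linarith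
    then have "norm (B y) * (norm (A y0 - A y) * \<beta>) \<le> 2 * \<beta> * (norm (A y0 - A y) * \<beta>)"
      using \<beta>(1) by (intro mult_right_mono) auto
    with 1 show ?thesis by (simp add: ac_simps)
  qed
  have "((\<lambda>y. 2 * \<beta> * \<beta> * norm (A y0 - A y)) \<longlongrightarrow> 0) (at y0 within V)"
    using tendsto_mult_left[OF lim, of "2 * \<beta> * \<beta>"] by simp
  then have "((\<lambda>y. B y - B y0) \<longlongrightarrow> 0) (at y0 within V)"
    by (rule Lim_null_comparison[rotated]) (use ev bound in \<open>auto elim: eventually_mono\<close>)
  then show "(B \<longlongrightarrow> B y0) (at y0 within V)" by (simp add: LIM_zero_iff)
qed

text \<open>
  The inverse function theorem in the form needed for straightening: the hypothesis on the derivative is triviality of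
  its kernel, and the inverse is again \<open>C\<^sup>1\<close>.
\<close>

lemma C1_local_inverse:
  fixes G :: "'a::euclidean_space \<Rightarrow> 'a"
  assumes W: "open W" and G: "C1_on G W" and w: "w0 \<in> W"
    and G0: "(G has_derivative G0) (at w0)" and ker: "\<And>v. G0 v = 0 \<Longrightarrow> v = 0"
  obtains V g where "open V" "G w0 \<in> V" "C1_on g V" "\<And>y. y \<in> V \<Longrightarrow> g y \<in> W \<and> G (g y) = y"
proof -
  obtain G' where G': "\<And>x. x \<in> W \<Longrightarrow> (G has_derivative blinfun_apply (G' x)) (at x)" "continuous_on W G'"
    using G W unfolding C1_on_def by (metis at_within_open)
  have eq: "blinfun_apply (G' w0) = G0"
    using has_derivative_unique[OF G'(1)[OF w] G0] .
  have lin: "linear G0" using G0 by (rule has_derivative_linear)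
  then have "inj G0" using ker linear_injective_0 by blast
  with lin obtain h where h: "linear h" "h \<circ> G0 = id"
    using linear_injective_left_inverse by blast
  have "Blinfun h o\<^sub>L G' w0 = id_blinfun"
    using h by (intro blinfun_eqI)
      (simp add: bounded_linear_Blinfun_apply linear_conv_bounded_linear[symmetric] eq fun_eq_iff)
  then obtain U V g g' where UV: "open U" "U \<subseteq> W" "w0 \<in> U" "open V" "G w0 \<in> V" "homeomorphism U V G g"
    and g: "\<And>y. y \<in> V \<Longrightarrow> (g has_derivative (g' y)) (at y)"
    "\<And>y. y \<in> V \<Longrightarrow> g' y = inv (blinfun_apply (G' (g y)))"
    "\<And>y. y \<in> V \<Longrightarrow> bij (blinfun_apply (G' (g y)))"
    using inverse_function_theorem[OF W G' w] by metis
  have gW: "g y \<in> W" "G (g y) = y" if "y \<in> V" for y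
    using UV(2) homeomorphism_image2[OF UV(6)] homeomorphism_apply2[OF UV(6)] that by blast+
  have appl: "blinfun_apply (Blinfun (g' y)) = g' y" if "y \<in> V" for y
    using has_derivative_bounded_linear[OF g(1)[OF that]] by (rule bounded_linear_Blinfun_apply)
  have "continuous_on V (\<lambda>y. Blinfun (g' y))"
  proof (rule continuous_on_blinfun_inverse)
    show "continuous_on V (\<lambda>y. G' (g y))"
      using gW(1) by (intro continuous_on_compose2[OF G'(2) homeomorphism_cont2[OF UV(6)]]) blast
    fix y v assume y: "y \<in> V"
    show "blinfun_apply (Blinfun (g' y)) (blinfun_apply (G' (g y)) v) = v"
      unfolding appl[OF y] using g(3)[OF y] by (simp add: g(2)[OF y] bij_is_inj)
    show "blinfun_apply (G' (g y)) (blinfun_apply (Blinfun (g' y)) v) = v"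
      unfolding appl[OF y] using g(3)[OF y] by (simp add: g(2)[OF y] bij_is_surj surj_f_inv_f)
  qed
  then have "C1_on g V"
    unfolding C1_on_def using g(1) appl
    by (intro exI[of _ "\<lambda>y. Blinfun (g' y)"]) (auto intro: has_derivative_at_withinI)
  then show ?thesis using that UV(4,5) gW by blast
qed

text \<open>
  Caratheodory's criterion: an exact factorisation of the increments through operators that are continuous at \<open>x\<close>
  replaces every estimate of a remainder term.
\<close>

lemma has_derivative_caratheodory:
  fixes f :: "'a::real_normed_vector \<Rightarrow> 'b::real_normed_vector" and A :: "'a \<Rightarrow> 'a \<Rightarrow>\<^sub>L 'b"
  assumes eq: "\<And>y. y \<in> Y \<Longrightarrow> f y - f x = A y (y - x)"
    and A: "continuous (at x within Y) A"
  shows "(f has_derivative A x) (at x within Y)"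
proof (rule has_derivativeI_sandwich[of 1 _ _ _ _ "\<lambda>y. norm (A y - A x)"])
  show "((\<lambda>y. norm (A y - A x)) \<longlongrightarrow> 0) (at x within Y)"
    using A unfolding continuous_within by (metis Lim_null tendsto_norm_zero)
  show "norm (f y - f x - A x (y - x)) / norm (y - x) \<le> norm (A y - A x)" if "y \<in> Y" "y \<noteq> x" for y
    using norm_blinfun[of "A y - A x" "y - x"] that eq[OF that(1)]
    by (simp add: blinfun.diff_left divide_le_eq)
qed (auto intro: blinfun.bounded_linear_right)

text \<open>
  \<open>Q a b\<close> is the mean of the derivative of \<open>P\<close> over the segment from \<open>a\<close> to \<open>b\<close>. It serves as a Lipschitz
  bound for \<open>P\<close> and, being continuous, as the coefficient of the linear equation for differences of solutions.
\<close>

lemma hadamard_quotient: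
  fixes P :: "'a::euclidean_space \<Rightarrow> 'b::euclidean_space"
  assumes P: "C1_on P UNIV" and K: "convex K" "compact K"
  obtains Q :: "'a \<Rightarrow> 'a \<Rightarrow> 'a \<Rightarrow>\<^sub>L 'b" and L :: real
  where "0 < L" "continuous_on (K \<times> K) (\<lambda>(a, b). Q a b)"
    and "\<And>a b. a \<in> K \<Longrightarrow> b \<in> K \<Longrightarrow> norm (Q a b) \<le> L"
    and "\<And>a b. a \<in> K \<Longrightarrow> b \<in> K \<Longrightarrow> P b - P a = Q a b (b - a)"
proof -
  obtain P' where P': "\<And>x. (P has_derivative blinfun_apply (P' x)) (at x)" "continuous_on UNIV P'"
    using P by (auto simp: C1_on_def)
  have P'K: "continuous_on K P'" using P'(2) continuous_on_subset by blast
  obtain L where L: "0 < L" "\<And>x. x \<in> K \<Longrightarrow> norm (P' x) \<le> L"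
    using compact_imp_bounded[OF compact_continuous_image[OF P'K K(2)]] by (auto simp: bounded_pos)
  define Q where "Q = (\<lambda>a b. integral {0..1} (\<lambda>\<theta>. P' (a + \<theta> *\<^sub>R (b - a))))"
  have seg: "a + \<theta> *\<^sub>R (b - a) \<in> K" if "a \<in> K" "b \<in> K" "\<theta> \<in> {0..1}" for a b \<theta>
  proof -
    have "(1 - \<theta>) *\<^sub>R a + \<theta> *\<^sub>R b \<in> K" using that K(1) by (intro convexD) auto
    then show ?thesis by (simp add: algebra_simps)
  qed
  have "continuous_on ((K \<times> K) \<times> cbox 0 1) (\<lambda>(x, \<theta>). P' (fst x + \<theta> *\<^sub>R (snd x - fst x)))"
    unfolding split_beta using seg
    by (intro continuous_on_compose2[OF P'K] continuous_intros) auto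
  from integral_continuous_on_param[OF this]
 have "continuous_on (K \<times> K) (\<lambda>(a, b). Q a b)" by (simp add: Q_def split_beta)
  moreover have "norm (Q a b) \<le> L" "P b - P a = Q a b (b - a)" if ab: "a \<in> K" "b \<in> K" for a b
  proof -
  have cont: "continuous_on {0..1} (\<lambda>\<theta>. P' (a + \<theta> *\<^sub>R (b - a)))"
    using seg[OF ab] by (intro continuous_on_compose2[OF P'K] continuous_intros) auto
  show "norm (Q a b) \<le> L"
    using integral_bound[OF _ cont, of L] L(2) seg[OF ab] by (simp add: Q_def)
  have "((\<lambda>\<theta>. P' (a + \<theta> *\<^sub>R (b - a))) has_integral Q a b) {0..1}"
    unfolding Q_def by (intro integrable_integral integrable_continuous_interval cont)
  from has_integral_linear[OF this blinfun.bounded_linear_left[of "b - a"]]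
  have "integral {0..1} (\<lambda>\<theta>. P' (a + \<theta> *\<^sub>R (b - a)) (b - a)) = Q a b (b - a)"
    by (simp add: o_def integral_unique)
  moreover have "P (a + (b - a)) - P a = integral {0..1} (\<lambda>\<theta>. P' (a + \<theta> *\<^sub>R (b - a)) (b - a))"
    using seg[OF ab] by (intro mvt_integral[of K P "\<lambda>x. blinfun_apply (P' x)"] has_derivative_at_withinI[OF P'(1)]) auto
  ultimately show "P b - P a = Q a b (b - a)" by simp
  qed
  ultimately show thesis using that L(1) by blast
qed

section \<open>Local flows of \<open>C\<^sup>1\<close> vector fields\<close>

text \<open>
  The expression is the integral of \<open>f\<close> from \<open>0\<close> to \<open>t\<close>, rescaled to a fixed interval. In this form
  negative times need no separate treatment, and continuity in parameters is continuity of an integral with fixed limits.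
\<close>

lemma scaled_integral_has_vector_derivative:
  fixes f :: "real \<Rightarrow> 'v::banach"
  assumes cont: "continuous_on {-e..e} f" and t: "t \<in> {-e..e}"
  shows "((\<lambda>t. t *\<^sub>R integral {0..1} (\<lambda>\<theta>. f (\<theta> * t))) has_vector_derivative f t) (at t within {-e..e})"
proof -
  \<comment> \<open>An antiderivative on the whole interval; the claim is that the rescaled integral is \<open>F t - F 0\<close>.\<close>
  define F where "F = (\<lambda>u. integral {-e..u} f)"
  have F: "(F has_vector_derivative f u) (at u within {-e..e})" if "u \<in> {-e..e}" for u
    unfolding F_def by (rule integral_has_vector_derivative[OF cont that])
  have eq: "u *\<^sub>R integral {0..1} (\<lambda>\<theta>. f (\<theta> * u)) = F u - F 0" if u: "u \<in> {-e..e}" for u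
  proof -
    have sub: "(\<lambda>\<theta>. \<theta> * u) ` {0..1} \<subseteq> {-e..e}"
    proof clarify
      fix \<theta> :: real assume "\<theta> \<in> {0..1}"
      then have "\<bar>\<theta> * u\<bar> \<le> 1 * \<bar>u\<bar>" unfolding abs_mult by (intro mult_right_mono) auto
      with u show "\<theta> * u \<in> {-e..e}" by auto
    qed
    have "((F \<circ> (\<lambda>\<theta>. \<theta> * u)) has_vector_derivative u *\<^sub>R f (\<theta> * u)) (at \<theta> within {0..1})"
      if "\<theta> \<in> {0..1}" for \<theta>
    proof (rule vector_diff_chain_within)
      show "((\<lambda>\<theta>. \<theta> * u) has_vector_derivative u) (at \<theta> within {0..1})"
        by (auto intro!: derivative_eq_intros simp: has_vector_derivative_def)
      show "(F has_vector_derivative f (\<theta> * u)) (at (\<theta> * u) within (\<lambda>\<theta>. \<theta> * u) ` {0..1})"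
        using sub that by (intro has_vector_derivative_within_subset[OF F]) blast+
    qed
    then have "((\<lambda>\<theta>. u *\<^sub>R f (\<theta> * u)) has_integral (F (1 * u) - F (0 * u))) {0..1}"
      using fundamental_theorem_of_calculus[of 0 1 "F \<circ> (\<lambda>\<theta>. \<theta> * u)" "\<lambda>\<theta>. u *\<^sub>R f (\<theta> * u)"]
      by (simp add: o_def)
    from integral_unique[OF this] show ?thesis by simp
  qed
  have "((\<lambda>u. F u - F 0) has_vector_derivative f t) (at t within {-e..e})"
    using F[OF t] by (auto intro!: derivative_eq_intros)
  then show ?thesis
    by (rule has_vector_derivative_transform[rotated 2]) (use eq t in auto)
qed

text \<open>
  The Picard operator acts on bounded continuous functions of time and parameter jointly, so its fixed point depends
  continuously on the parameter without further argument. The initial value zero keeps the fixed point bounded even if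
  the parameter space is not: solutions with initial value \<open>x\<close> are obtained by putting \<open>x\<close> into the parameter.
\<close>

lemma parametric_picard:
  fixes G :: "real \<Rightarrow> 'l::metric_space \<Rightarrow> 'v::banach \<Rightarrow> 'v"
  assumes e: "0 < e" and L: "0 \<le> L" "L * e \<le> 1/2"
    and cont: "continuous_on UNIV (\<lambda>(t, l, v). G t l v)"
    and lip: "\<And>t l v w. norm (G t l v - G t l w) \<le> L * norm (v - w)"
    and bound: "\<And>t l. norm (G t l 0) \<le> M"
  obtains X where "continuous_on UNIV (\<lambda>(t, l). X t l)"
    and "\<And>l. X 0 l = 0"
    and "\<And>t l. t \<in> {-e..e} \<Longrightarrow>
           ((\<lambda>t. X t l) has_vector_derivative G t l (X t l)) (at t within {-e..e})"
proof -
  \<comment> \<open>Clamping the time extends the operator to functions on the whole line, as the type of bounded continuous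
    functions demands.\<close>
  define c where "c = (\<lambda>t::real. max (-e) (min e t))"
  have c_le: "\<bar>c t\<bar> \<le> e" for t using e by (auto simp: c_def)
  have c_id: "c t = t" if "t \<in> {-e..e}" for t using that by (auto simp: c_def)
  have c_cont: "continuous_on A (\<lambda>x. c (g x))" if "continuous_on A g" for A and g :: "'z::topological_space \<Rightarrow> real"
    unfolding c_def by (intro continuous_intros that)
  define I where "I = (\<lambda>w (t, l). integral {0..1} (\<lambda>\<theta>. G (\<theta> * c t) l (w (\<theta> * c t, l))))"
  define T where "T = (\<lambda>w (t, l). c t *\<^sub>R I w (t, l))"
  have G_cont: "continuous_on A (\<lambda>x. G (f x) (g x) (h x))"
    if "continuous_on A f" "continuous_on A g" "continuous_on A h"
    for A :: "'z::topological_space set" and f g h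
    using continuous_on_compose2[OF cont continuous_on_Pair[OF that(1) continuous_on_Pair[OF that(2,3)]]]
    by simp
  have M: "0 \<le> M" using bound norm_ge_zero order_trans by blast
  have int: "(\<lambda>\<theta>. G (\<theta> * c t) l (w (\<theta> * c t, l))) integrable_on {0..1}"
    if w: "continuous_on UNIV w" for w t l
    by (intro integrable_continuous_interval G_cont continuous_intros
        continuous_on_compose2[OF w]) auto
  have T_cont: "continuous_on UNIV (T w)" if w: "continuous_on UNIV w" for w
  proof -
    have "continuous_on (UNIV \<times> cbox 0 1)
        (\<lambda>(x, \<theta>). G (\<theta> * c (fst x)) (snd x) (w (\<theta> * c (fst x), snd x)))"
      unfolding split_beta
      by (intro G_cont continuous_intros c_cont continuous_on_compose2[OF w]) auto
    from integral_continuous_on_param[OF this] have "continuous_on UNIV (I w)"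
      by (simp add: I_def split_beta)
    then show ?thesis unfolding T_def split_beta
      by (intro continuous_intros c_cont) simp
  qed
  have T_bdd: "norm (T w x) \<le> e * (M + L * B)"
    if w: "continuous_on UNIV w" and B: "\<And>x. norm (w x) \<le> B" for w x B
  proof (cases x)
    case (Pair t l)
    have "0 \<le> B" using B norm_ge_zero order_trans by blast
    have "norm (G (\<theta> * c t) l (w (\<theta> * c t, l))) \<le> M + L * B" for \<theta>
    proof -
      have "norm (G (\<theta> * c t) l (w (\<theta> * c t, l)))
          \<le> norm (G (\<theta> * c t) l 0) + norm (G (\<theta> * c t) l (w (\<theta> * c t, l)) - G (\<theta> * c t) l 0)"
        by (metis add.commute diff_add_cancel norm_triangle_ineq)
      also have "\<dots> \<le> M + L * norm (w (\<theta> * c t, l))"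
        using bound lip[of _ _ _ 0] by (intro add_mono) auto
      also have "\<dots> \<le> M + L * B" using B L by (intro add_left_mono mult_left_mono) auto
      finally show ?thesis .
    qed
    then have "norm (I w x) \<le> (M + L * B) * (1 - 0)"
      unfolding I_def Pair split
      by (intro integral_bound G_cont continuous_intros continuous_on_compose2[OF w]) auto
    then show ?thesis unfolding T_def Pair split norm_scaleR
      using c_le M L \<open>0 \<le> B\<close> e by (intro mult_mono) auto
  qed
  have T_lip: "norm (T w x - T w' x) \<le> 1/2 * B"
    if w: "continuous_on UNIV w" "continuous_on UNIV w'" and B: "\<And>x. norm (w x - w' x) \<le> B" for w w' x B
  proof (cases x)
    case (Pair t l)
    have B0: "0 \<le> B" using B norm_ge_zero order_trans by blast
    have "norm (G (\<theta> * c t) l (w (\<theta> * c t, l)) - G (\<theta> * c t) l (w' (\<theta> * c t, l))) \<le> L * B" for \<theta>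
      by (rule order_trans[OF lip]) (use B L in \<open>auto intro: mult_left_mono\<close>)
    then have "norm (integral {0..1} (\<lambda>\<theta>. G (\<theta> * c t) l (w (\<theta> * c t, l)) - G (\<theta> * c t) l (w' (\<theta> * c t, l)))) \<le> (L * B) * (1 - 0)"
      by (intro integral_bound G_cont continuous_intros continuous_on_compose2[OF w(1)] continuous_on_compose2[OF w(2)]) auto
    then have "norm (I w x - I w' x) \<le> L * B"
      unfolding I_def Pair split by (subst Henstock_Kurzweil_Integration.integral_diff[symmetric, OF int int]) (use w in auto)
    then have "norm (T w x - T w' x) \<le> e * (L * B)"
      unfolding T_def Pair split scaleR_diff_right[symmetric] norm_scaleR
      using c_le e by (intro mult_mono) auto
    also have "\<dots> = (L * e) * B" by simp
    also have "\<dots> \<le> 1/2 * B" using L B0 by (intro mult_right_mono) auto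
    finally show ?thesis .
  qed
  define TT where "TT = (\<lambda>w :: (real \<times> 'l) \<Rightarrow>\<^sub>C 'v. Bcontfun (T (apply_bcontfun w)))"
  have TT: "apply_bcontfun (TT w) = T (apply_bcontfun w)" for w
  proof -
    obtain B where B: "\<And>x. norm (apply_bcontfun w x) \<le> B"
      using bounded_apply_bcontfun[of w] by (auto simp: bounded_iff)
    have "T (apply_bcontfun w) \<in> bcontfun"
      by (rule bcontfun_normI[OF T_cont T_bdd[OF _ B]]) auto
    then show ?thesis by (simp add: TT_def Bcontfun_inverse)
  qed
  have "dist (TT w) (TT w') \<le> 1/2 * dist w w'" for w w'
  proof (rule dist_bound)
    show "dist (TT w x) (TT w' x) \<le> 1/2 * dist w w'" for x
      unfolding TT dist_norm by (rule T_lip) (use dist_bounded[of w _ w'] in \<open>auto simp: dist_norm\<close>)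
  qed
  then obtain w where w: "TT w = w"
    using banach_fix_type[of "1/2" TT] by auto
  have wT: "apply_bcontfun w x = T (apply_bcontfun w) x" for x
    using TT[of w] w by simp
  define X where "X = (\<lambda>t l. apply_bcontfun w (t, l))"
  have Xcont: "continuous_on UNIV (\<lambda>(t, l). X t l)"
    unfolding X_def by (simp add: split_beta)
  have XG: "continuous_on A (\<lambda>t. G t l (X t l))" for l A
    unfolding X_def by (intro G_cont continuous_intros continuous_on_compose2[OF continuous_on_apply_bcontfun[of UNIV w]]) auto
  have "((\<lambda>t. X t l) has_vector_derivative G t l (X t l)) (at t within {-e..e})"
    if t: "t \<in> {-e..e}" for t l
  proof -
    have "X u l = u *\<^sub>R integral {0..1} (\<lambda>\<theta>. G (\<theta> * u) l (X (\<theta> * u) l))" if "u \<in> {-e..e}" for u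
      using wT[of "(u, l)"] c_id[OF that] by (simp add: X_def T_def I_def)
    then show ?thesis
      by (intro has_vector_derivative_transform[OF t _ scaled_integral_has_vector_derivative[OF XG t]]) auto
  qed
  moreover have "X 0 l = 0" for l
    using wT[of "(0, l)"] c_id[of 0] e by (simp add: X_def T_def)
  ultimately show ?thesis using Xcont that by blast
qed

text \<open>
  On so short an interval Gronwall's inequality reduces to the mean value theorem: the maximum of \<open>norm (z t)\<close> is at
  most half of itself.
\<close>

lemma gronwall_zero:
  fixes z :: "real \<Rightarrow> 'v::real_normed_vector"
  assumes L: "0 \<le> L" "L * e \<le> 1/2"
    and z0: "z 0 = 0"
    and deriv: "\<And>t. t \<in> {-e..e} \<Longrightarrow> (z has_vector_derivative z' t) (at t within {-e..e})"
    and bound: "\<And>t. t \<in> {-e..e} \<Longrightarrow> norm (z' t) \<le> L * norm (z t)"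
    and t: "t \<in> {-e..e}"
  shows "z t = 0"
proof -
  have "continuous_on {-e..e} z"
    using deriv by (meson continuous_on_eq_continuous_within has_vector_derivative_continuous)
  then have "continuous_on {-e..e} (\<lambda>t. norm (z t))" by (intro continuous_intros)
  then obtain s where s: "s \<in> {-e..e}" and max: "\<And>u. u \<in> {-e..e} \<Longrightarrow> norm (z u) \<le> norm (z s)"
    using continuous_attains_sup[of "{-e..e}" "\<lambda>t. norm (z t)"] t by auto
  have e: "0 \<le> e" using t by auto
  have "norm (z s - z 0) \<le> (L * norm (z s)) * norm (s - 0)"
  proof (rule differentiable_bound[of "{-e..e}"])
    show "(z has_derivative (\<lambda>h. h *\<^sub>R z' u)) (at u within {-e..e})" if "u \<in> {-e..e}" for u
      using deriv[OF that] by (simp add: has_vector_derivative_def)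
    show "onorm (\<lambda>h. h *\<^sub>R z' u) \<le> L * norm (z s)" if "u \<in> {-e..e}" for u
    proof -
      have "norm (z' u) \<le> L * norm (z s)"
        using bound[OF that] mult_left_mono[OF max[OF that] L(1)] by linarith
      then show ?thesis by (intro onorm_bound) (use L in \<open>auto simp: mult.commute intro: mult_left_mono\<close>)
    qed
  qed (use s e in auto)
  also have "\<dots> \<le> (L * norm (z s)) * e" using s L by (intro mult_left_mono) auto
  also have "\<dots> = (L * e) * norm (z s)" by simp
  also have "\<dots> \<le> 1/2 * norm (z s)" using L by (intro mult_right_mono) auto
  finally have "norm (z s) \<le> 0" using z0 by simp
  then show ?thesis using max[OF t] by simp
qed

text \<open>
  The two applications of \<open>parametric_picard\<close> concern the equation itself, with \<open>P\<close> composed with the nearest-point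
  projection onto a ball to make it globally Lipschitz, and the linear equation for differences of solutions.
\<close>

lemma local_flow:
  fixes P :: "'a::euclidean_space \<Rightarrow> 'a"
  assumes "C1_on P UNIV"
  obtains e r :: real and \<phi> where "0 < e" "0 < r"
    and "\<And>x. x \<in> ball x0 r \<Longrightarrow> \<phi> 0 x = x"
    and "\<And>t x. t \<in> {-e<..<e} \<Longrightarrow> x \<in> ball x0 r \<Longrightarrow>
          ((\<lambda>t. \<phi> t x) has_vector_derivative P (\<phi> t x)) (at t)"
    and "C1_on (\<lambda>(t, x). \<phi> t x) ({-e<..<e} \<times> ball x0 r)"
proof -
  define K where "K = cball x0 1"
  have K: "convex K" "closed K" "K \<noteq> {}" "compact K" by (auto simp: K_def)
  have Pcont: "continuous_on A P" for A
    using C1_on_imp_continuous_on[OF assms] continuous_on_subset by blast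
  obtain Q L where L: "0 < L" and Q: "continuous_on (K \<times> K) (\<lambda>(a, b). Q a b)"
      "\<And>a b. a \<in> K \<Longrightarrow> b \<in> K \<Longrightarrow> norm (Q a b) \<le> L"
      "\<And>a b. a \<in> K \<Longrightarrow> b \<in> K \<Longrightarrow> P b - P a = blinfun_apply (Q a b) (b - a)"
    by (rule hadamard_quotient[OF assms K(1,4)]) (rule that)
  obtain M where M: "0 < M" "\<And>x. x \<in> K \<Longrightarrow> norm (P x) \<le> M"
    using compact_imp_bounded[OF compact_continuous_image[OF Pcont K(4)]]
    by (auto simp: bounded_pos)
  have Plip: "norm (P x - P y) \<le> L * norm (x - y)" if "x \<in> K" "y \<in> K" for x y
    using Q(3)[OF that(2,1)] norm_blinfun[of "Q y x" "x - y"]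
      mult_right_mono[OF Q(2)[OF that(2,1)] norm_ge_zero[of "x - y"]] by simp
  define \<pi> where "\<pi> = closest_point K"
  have pi_in: "\<pi> x \<in> K" for x unfolding \<pi>_def by (rule closest_point_in_set[OF K(2,3)])
  have pi_id: "\<pi> x = x" if "x \<in> K" for x unfolding \<pi>_def by (rule closest_point_self[OF that])
  have pi_lip: "norm (\<pi> x - \<pi> y) \<le> norm (x - y)" for x y
    using closest_point_lipschitz[OF K(1,2,3)] by (simp add: \<pi>_def dist_norm)
  have pi_cont: "continuous_on A (\<lambda>x. \<pi> (g x))" if "continuous_on A g"
    for A and g :: "'z::topological_space \<Rightarrow> 'a"
    using continuous_on_compose2[OF continuous_on_closest_point[OF K(1-3), of UNIV] that]
    by (simp add: \<pi>_def)
  \<comment> \<open>The first bound makes the Picard operator a contraction; the second keeps solutions that start in the ball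
    of radius \<open>1/2\<close> inside \<open>K\<close>, where the projection is the identity.\<close>
  define e where "e = min (1 / (2 * L)) (1 / (2 * M))"
  have e: "0 < e" "L * e \<le> 1/2" "M * e \<le> 1/2"
    using L M(1) by (auto simp: e_def min_def field_simps)

  have lip: "norm (P (\<pi> (l + v)) - P (\<pi> (l + w))) \<le> L * norm (v - w)" for l v w
  proof -
    have "norm (P (\<pi> (l + v)) - P (\<pi> (l + w))) \<le> L * norm (\<pi> (l + v) - \<pi> (l + w))"
      by (intro Plip pi_in)
    also have "\<dots> \<le> L * norm (v - w)"
      using pi_lip[of "l + v" "l + w"] L by (intro mult_left_mono) auto
    finally show ?thesis .
  qed
  obtain X where X: "continuous_on UNIV (\<lambda>(t, l). X t l)" "\<And>l. X 0 l = 0"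
      "\<And>t l. t \<in> {-e..e} \<Longrightarrow>
         ((\<lambda>t. X t l) has_vector_derivative P (\<pi> (l + X t l))) (at t within {-e..e})"
  proof (rule parametric_picard[of e L "\<lambda>t l v. P (\<pi> (l + v))" M])
    show "continuous_on UNIV (\<lambda>(t::real, l, v). P (\<pi> (l + v)))"
      unfolding split_beta
      by (intro continuous_on_compose2[OF Pcont[of UNIV]] pi_cont continuous_intros) auto
  qed (use e L M pi_in lip in auto)
  define \<phi> where "\<phi> = (\<lambda>t x. x + X t x)"
  have phi_cont: "continuous_on A (\<lambda>z. \<phi> (f z) (g z))" if "continuous_on A f" "continuous_on A g"
    for A :: "'z::topological_space set" and f g
    using continuous_on_compose2[OF X(1) continuous_on_Pair[OF that]] that
    by (auto simp: \<phi>_def intro!: continuous_intros)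
  have phi0: "\<phi> 0 x = x" for x by (simp add: \<phi>_def X)
  have phi_in: "\<phi> t x \<in> K" if t: "t \<in> {-e..e}" and x: "x \<in> ball x0 (1/2)" for t x
  proof -
    have "norm (X t x - X 0 x) \<le> M * norm (t - 0)"
    proof (rule differentiable_bound[of "{-e..e}"])
      show "((\<lambda>t. X t x) has_derivative (\<lambda>h. h *\<^sub>R P (\<pi> (x + X u x)))) (at u within {-e..e})"
        if "u \<in> {-e..e}" for u
        using X(3)[OF that] by (simp add: has_vector_derivative_def)
      show "onorm (\<lambda>h. h *\<^sub>R P (\<pi> (x + X u x))) \<le> M" for u
      proof (rule onorm_bound)
        show "norm (h *\<^sub>R P (\<pi> (x + X u x))) \<le> M * norm h" for h :: real
          using mult_right_mono[OF M(2)[OF pi_in] norm_ge_zero[of h]] by (simp add: mult.commute)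
      qed (use M in auto)
    qed (use t e in auto)
    also have "\<dots> \<le> M * e" using t M by (intro mult_left_mono) auto
    finally have "norm (X t x) \<le> 1/2" using X(2) e(3) by auto
    moreover have "norm (x - x0) < 1/2" using x by (simp add: dist_norm norm_minus_commute)
    ultimately have "norm ((x - x0) + X t x) \<le> 1"
      by (intro order_trans[OF norm_triangle_ineq]) auto
    then show ?thesis by (simp add: K_def \<phi>_def dist_norm norm_minus_commute algebra_simps)
  qed
  have phi_deriv: "((\<lambda>t. \<phi> t x) has_vector_derivative P (\<phi> t x)) (at t within {-e..e})"
    if "t \<in> {-e..e}" "x \<in> ball x0 (1/2)" for t x
    using X(3)[OF that(1), of x] pi_id[OF phi_in[OF that]]
    by (auto simp: \<phi>_def intro!: derivative_eq_intros)

  define R where "R = (\<lambda>t l. Q (\<pi> (\<phi> t (fst l))) (\<pi> (\<phi> t (snd l))))"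
  have R_le: "norm (R t l) \<le> L" for t l unfolding R_def by (intro Q pi_in)
  have R_cont: "continuous_on A (\<lambda>z. R (f z) (g z))"
    if "continuous_on A f" "continuous_on A g"
    for A :: "'z::topological_space set" and f g
    using continuous_on_compose2[OF Q(1) continuous_on_Pair[OF
        pi_cont[OF phi_cont[OF that(1) continuous_on_fst[OF that(2)]]]
        pi_cont[OF phi_cont[OF that(1) continuous_on_snd[OF that(2)]]]]] pi_in
    by (auto simp: R_def)
  obtain Z :: "real \<Rightarrow> 'a \<times> 'a \<Rightarrow> 'a \<Rightarrow>\<^sub>L 'a" where Z: "continuous_on UNIV (\<lambda>(t, l). Z t l)" "\<And>l. Z 0 l = 0"
      "\<And>t l. t \<in> {-e..e} \<Longrightarrow>
         ((\<lambda>t. Z t l) has_vector_derivative R t l o\<^sub>L (id_blinfun + Z t l)) (at t within {-e..e})"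
  proof (rule parametric_picard[of e L "\<lambda>t l v. R t l o\<^sub>L (id_blinfun + v)" L])
    show "continuous_on UNIV (\<lambda>(t, l, v). R t l o\<^sub>L (id_blinfun + v))"
      unfolding split_beta by (intro continuous_intros R_cont)
    show "norm ((R t l o\<^sub>L (id_blinfun + v)) - (R t l o\<^sub>L (id_blinfun + w))) \<le> L * norm (v - w)" for t l v w
    proof -
      have "(R t l o\<^sub>L (id_blinfun + v)) - (R t l o\<^sub>L (id_blinfun + w)) = R t l o\<^sub>L (v - w)"
        by (auto intro!: blinfun_eqI simp: blinfun.bilinear_simps)
      then show ?thesis
        using norm_blinfun_compose[of "R t l" "v - w"] mult_right_mono[OF R_le[of t l] norm_ge_zero[of "v - w"]]
        by simp
    qed
    show "norm (R t l o\<^sub>L (id_blinfun + 0)) \<le> L" for t l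
    proof -
      have "R t l o\<^sub>L (id_blinfun + 0) = R t l" by (auto intro!: blinfun_eqI)
      then show ?thesis using R_le by simp
    qed
  qed (use e L in auto)
  \<comment> \<open>The solution operator of the linear equation \<open>\<Psi>' = R \<circ> \<Psi>\<close> with \<open>\<Psi> = id\<close> at time zero.\<close>
  define \<Psi> where "\<Psi> = (\<lambda>t x y. id_blinfun + Z t (x, y))"
  have Psi: "\<phi> t y - \<phi> t x = \<Psi> t x y (y - x)"
    if t: "t \<in> {-e..e}" and xy: "x \<in> ball x0 (1/2)" "y \<in> ball x0 (1/2)" for t x y
  proof -
    \<comment> \<open>\<open>\<phi> t y - \<phi> t x\<close> and \<open>\<Psi> t x y (y - x)\<close> solve the same linear equation with the same initial value.\<close>
    define z where "z = (\<lambda>t. \<phi> t y - \<phi> t x - \<Psi> t x y (y - x))"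
    have "z t = 0"
    proof (rule gronwall_zero[of L e z "\<lambda>t. R t (x, y) (z t)"])
      show "z 0 = 0" by (simp add: z_def phi0 \<Psi>_def Z)
      fix u assume u: "u \<in> {-e..e}"
      have 1: "P (\<phi> u y) - P (\<phi> u x) = R u (x, y) (\<phi> u y - \<phi> u x)"
        using Q(3)[OF phi_in[OF u xy(1)] phi_in[OF u xy(2)]]
        by (simp add: R_def pi_id[OF phi_in[OF u xy(1)]] pi_id[OF phi_in[OF u xy(2)]])
      have "((\<lambda>t. Z t (x, y) (y - x)) has_vector_derivative
              (R u (x, y) o\<^sub>L \<Psi> u x y) (y - x)) (at u within {-e..e})"
        using bounded_linear.has_vector_derivative[OF blinfun.bounded_linear_left Z(3)[OF u]]
        by (simp add: \<Psi>_def)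
      from has_vector_derivative_add[OF has_vector_derivative_const this, of "y - x"]
      have "((\<lambda>t. \<Psi> t x y (y - x)) has_vector_derivative
              R u (x, y) (\<Psi> u x y (y - x))) (at u within {-e..e})"
        by (simp add: \<Psi>_def blinfun.add_left)
      from has_vector_derivative_diff[OF has_vector_derivative_diff[OF
          phi_deriv[OF u xy(2)] phi_deriv[OF u xy(1)]] this]
      show "(z has_vector_derivative R u (x, y) (z u)) (at u within {-e..e})"
        unfolding z_def 1 blinfun.diff_right .
      show "norm (R u (x, y) (z u)) \<le> L * norm (z u)"
        by (rule order_trans[OF norm_blinfun]) (intro mult_right_mono R_le norm_ge_zero)
    qed (use L e t in auto)
    then show ?thesis by (simp add: z_def)
  qed
  have Psi_cont: "continuous_on A (\<lambda>z. \<Psi> (f z) (g z) (h z))"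
    if "continuous_on A f" "continuous_on A g" "continuous_on A h"
    for A :: "'z::topological_space set" and f g h
    using continuous_on_compose2[OF Z(1) continuous_on_Pair[OF that(1) continuous_on_Pair[OF that(2,3)]]]
    by (auto simp: \<Psi>_def intro!: continuous_intros)
  have Psi_diag_cont: "continuous_on UNIV (\<lambda>z. \<Psi> (fst z) (snd z) (snd z))"
    using Psi_cont[OF continuous_on_fst[OF continuous_on_id]
        continuous_on_snd[OF continuous_on_id] continuous_on_snd[OF continuous_on_id]] .
  have P_phi_cont: "continuous_on UNIV (\<lambda>z. P (\<phi> (fst z) (snd z)))"
    using continuous_on_compose2[OF Pcont phi_cont[OF continuous_on_fst[OF continuous_on_id]
        continuous_on_snd[OF continuous_on_id]] subset_UNIV] .
  have partial_x: "(\<phi> t has_derivative \<Psi> t x x) (at x within ball x0 (1/2))"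
    if "t \<in> {-e<..<e}" "x \<in> ball x0 (1/2)" for t x
  proof (rule has_derivative_caratheodory[where A = "\<Psi> t x"])
    show "\<phi> t y - \<phi> t x = \<Psi> t x y (y - x)" if "y \<in> ball x0 (1/2)" for y
      using Psi[OF _ _ that] \<open>t \<in> _\<close> \<open>x \<in> _\<close> by auto
    show "continuous (at x within ball x0 (1/2)) (\<Psi> t x)"
      by (rule continuous_on_imp_continuous_within[OF Psi_cont[OF continuous_on_const
            continuous_on_const continuous_on_id] subset_UNIV UNIV_I])
  qed
  have partial_t: "((\<lambda>t. \<phi> t x) has_vector_derivative P (\<phi> t x)) (at t)"
    if "t \<in> {-e<..<e}" "x \<in> ball x0 (1/2)" for t x
    using has_vector_derivative_within_subset[OF phi_deriv[of t x], of "{-e<..<e}"]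
      at_within_open[of t "{-e<..<e}"] that
    by force
  define D where "D = (\<lambda>(t, x). (blinfun_scaleR_left (P (\<phi> t x)) o\<^sub>L fst_blinfun) + (\<Psi> t x x o\<^sub>L snd_blinfun))"
  have "((\<lambda>(t, x). \<phi> t x) has_derivative D z) (at z within {-e<..<e} \<times> ball x0 (1/2))"
    if z: "z \<in> {-e<..<e} \<times> ball x0 (1/2)" for z
  proof -
    obtain t x where tx: "z = (t, x)" "t \<in> {-e<..<e}" "x \<in> ball x0 (1/2)" using z by auto
    have "((\<lambda>(t, x). \<phi> t x) has_derivative (\<lambda>(s, v). s *\<^sub>R P (\<phi> t x) + \<Psi> t x x v))
        (at (t, x) within {-e<..<e} \<times> ball x0 (1/2))"
    proof (rule has_derivative_partialsI[where fy = "\<lambda>t x. \<Psi> t x x"])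
      show "((\<lambda>t. \<phi> t x) has_derivative (\<lambda>s. s *\<^sub>R P (\<phi> t x))) (at t within {-e<..<e})"
        using partial_t[OF tx(2,3)] by (auto simp: has_vector_derivative_def intro: has_derivative_at_withinI)
      show "continuous (at (t, x) within {-e<..<e} \<times> ball x0 (1/2)) (\<lambda>(t, x). \<Psi> t x x)"
        unfolding split_beta
        by (rule continuous_on_imp_continuous_within[OF Psi_diag_cont subset_UNIV UNIV_I])
      show "(\<phi> s has_derivative \<Psi> s y y) (at y within ball x0 (1/2))"
        if "s \<in> {-e<..<e}" "y \<in> ball x0 (1/2)" for s y
        using partial_x[OF that] .
    qed (rule tx(3) convex_ball)+
    moreover have "blinfun_apply (D z) = (\<lambda>(s, v). s *\<^sub>R P (\<phi> t x) + \<Psi> t x x v)"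
      by (rule ext) (simp add: D_def tx blinfun.add_left split_beta)
    ultimately show ?thesis using tx(1) by simp
  qed
  moreover have "continuous_on UNIV D"
    unfolding D_def split_beta
    by (intro continuous_on_add bounded_bilinear.continuous_on[OF bounded_bilinear_blinfun_compose]
        bounded_linear.continuous_on[OF bounded_linear_blinfun_scaleR_left] continuous_on_const P_phi_cont Psi_diag_cont)
  ultimately have "C1_on (\<lambda>(t, x). \<phi> t x) ({-e<..<e} \<times> ball x0 (1/2))"
    unfolding C1_on_def by (meson continuous_on_subset subset_UNIV)
  then show ?thesis
    by (intro that[of e "1/2" \<phi>] e(1) phi0 partial_t) simp_all
qed

section \<open>Orbits\<close>

lemma ode_solution_shift:
  assumes "ode_solution P I x"
  shows "ode_solution P ((+) c ` I) (\<lambda>t. x (t - c))"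
proof -
  have "((\<lambda>t. x (t - c)) has_vector_derivative P (x (t - c))) (at t)" if "t \<in> (+) c ` I" for t
  proof -
    have "(x has_vector_derivative P (x (t - c))) (at (t - c))"
      using assms that by (auto simp: ode_solution_def)
    moreover have "((\<lambda>t. t - c) has_vector_derivative 1) (at t)"
      by (auto intro!: derivative_eq_intros)
    ultimately show ?thesis
      using vector_diff_chain_at[of "\<lambda>t. t - c" 1 t x] by (simp add: o_def)
  qed
  then show ?thesis
    using assms unfolding ode_solution_def by (auto intro: open_translation)
qed

lemma ode_solution_continuous: "ode_solution P I x \<Longrightarrow> continuous_on I x"
  unfolding ode_solution_def
  by (meson continuous_at_imp_continuous_on has_vector_derivative_continuous)

lemma ode_solution_unique_near:
  fixes P :: "'a::euclidean_space \<Rightarrow> 'a"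
  assumes P: "C1_on P UNIV" and x: "ode_solution P I x" and y: "ode_solution P J y"
    and a: "a \<in> I \<inter> J" "x a = y a"
  obtains d where "0 < d" "\<And>t. \<bar>t - a\<bar> \<le> d \<Longrightarrow> t \<in> I \<inter> J \<and> x t = y t"
proof -
  obtain Q L where L: "0 < L" and "continuous_on (cball (x a) 1 \<times> cball (x a) 1) (\<lambda>(u, v). Q u v)"
    and Q: "\<And>u v. u \<in> cball (x a) 1 \<Longrightarrow> v \<in> cball (x a) 1 \<Longrightarrow> norm (Q u v) \<le> L"
      "\<And>u v. u \<in> cball (x a) 1 \<Longrightarrow> v \<in> cball (x a) 1 \<Longrightarrow> P v - P u = blinfun_apply (Q u v) (v - u)"
    by (rule hadamard_quotient[OF P convex_cball compact_cball]) (rule that)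
  have op: "open I" "open J" using x y by (auto simp: ode_solution_def)
  have "open (x -` ball (x a) 1 \<inter> I)" "open (y -` ball (x a) 1 \<inter> J)"
    using ode_solution_continuous[OF x] ode_solution_continuous[OF y] op
    by (simp_all add: continuous_on_open_vimage)
  then have "open ((x -` ball (x a) 1 \<inter> I) \<inter> (y -` ball (x a) 1 \<inter> J))" by blast
  moreover have "a \<in> (x -` ball (x a) 1 \<inter> I) \<inter> (y -` ball (x a) 1 \<inter> J)" using a by auto
  ultimately obtain \<epsilon> where eps: "0 < \<epsilon>" "cball a \<epsilon> \<subseteq> (x -` ball (x a) 1 \<inter> I) \<inter> (y -` ball (x a) 1 \<inter> J)"
    by (meson open_contains_cball)
  define d where "d = min \<epsilon> (1 / (2 * L))"
  have d: "0 < d" "d \<le> \<epsilon>" "L * d \<le> 1/2" using eps L by (auto simp: d_def min_def field_simps)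
  have near: "t \<in> I \<inter> J" "x t \<in> cball (x a) 1" "y t \<in> cball (x a) 1" if "\<bar>t - a\<bar> \<le> d" for t
    using subsetD[OF eps(2), of t] that d by (auto simp: dist_real_def less_imp_le)
  have "x (a + t) - y (a + t) = 0" if "t \<in> {-d..d}" for t
  proof (rule gronwall_zero[where z = "\<lambda>t. x (a + t) - y (a + t)" and z' = "\<lambda>t. P (x (a + t)) - P (y (a + t))"])
    fix s assume s: "s \<in> {-d..d}"
    then have s': "\<bar>(a + s) - a\<bar> \<le> d" by auto
    have chain: "((\<lambda>t. w (a + t)) has_vector_derivative w') (at s)"
      if w: "(w has_vector_derivative w') (at (a + s))" for w :: "real \<Rightarrow> 'a" and w'
    proof -
      have "((\<lambda>t. a + t) has_vector_derivative 1) (at s)"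
        by (auto intro!: derivative_eq_intros)
      then show ?thesis
        using vector_diff_chain_at[of "\<lambda>t. a + t" 1 s w] w by (simp add: o_def)
    qed
    have "((\<lambda>t. x (a + t)) has_vector_derivative P (x (a + s))) (at s)"
      "((\<lambda>t. y (a + t)) has_vector_derivative P (y (a + s))) (at s)"
      using near(1)[OF s'] x y chain by (auto simp: ode_solution_def)
    then show "((\<lambda>t. x (a + t) - y (a + t)) has_vector_derivative P (x (a + s)) - P (y (a + s))) (at s within {-d..d})"
      by (rule has_vector_derivative_at_within[OF has_vector_derivative_diff])
    show "norm (P (x (a + s)) - P (y (a + s))) \<le> L * norm (x (a + s) - y (a + s))"
      unfolding Q(2)[OF near(3,2)[OF s']]
      by (rule order_trans[OF norm_blinfun mult_right_mono[OF Q(1)[OF near(3,2)[OF s']] norm_ge_zero]])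
  qed (use L d a that in auto)
  note eq = this
  show ?thesis
  proof (rule that[OF d(1)])
    fix t assume t: "\<bar>t - a\<bar> \<le> d"
    then have "t - a \<in> {-d..d}" by auto
    from eq[OF this] near(1)[OF t] show "t \<in> I \<inter> J \<and> x t = y t" by simp
  qed
qed

text \<open>
  Agreement is an open condition on times by local uniqueness, and disagreement is one by continuity.
\<close>

lemma ode_solution_unique:
  fixes P :: "'a::euclidean_space \<Rightarrow> 'a"
  assumes P: "C1_on P UNIV" and x: "ode_solution P I x" and y: "ode_solution P J y"
    and a: "a \<in> I \<inter> J" "x a = y a" and t: "t \<in> I \<inter> J"
  shows "x t = y t"
proof (rule connected_induction_simple[where S = "I \<inter> J" and P = "\<lambda>t. x t = y t", OF _ a(1) t a(2)])
  have op: "open I" "open J" and iv: "is_interval I" "is_interval J"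
    using x y by (auto simp: ode_solution_def)
  show "connected (I \<inter> J)"
    using is_interval_Int[OF iv] by (simp add: is_interval_connected)
  fix s assume s: "s \<in> I \<inter> J"
  show "\<exists>T. openin (top_of_set (I \<inter> J)) T \<and> s \<in> T \<and> (\<forall>u\<in>T. \<forall>v\<in>T. x u = y u \<longrightarrow> x v = y v)"
  proof (cases "x s = y s")
    case True
    from ode_solution_unique_near[OF P x y s this] obtain d where
      d: "0 < d" "\<And>t. \<bar>t - s\<bar> \<le> d \<Longrightarrow> t \<in> I \<inter> J \<and> x t = y t" by blast
    then have "ball s d \<subseteq> I \<inter> J" "\<forall>v\<in>ball s d. x v = y v" by (auto simp: dist_real_def)
    then show ?thesis using d(1) by (intro exI[of _ "ball s d"]) (auto intro: open_subset)
  next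
    case False
    have c: "continuous_on (I \<inter> J) x" "continuous_on (I \<inter> J) y"
      using ode_solution_continuous[OF x] ode_solution_continuous[OF y] continuous_on_subset by blast+
    have "open (I \<inter> J \<inter> {t. (x t - y t) \<in> - {0}})"
      using continuous_open_preimage[of "I \<inter> J" "\<lambda>t. x t - y t" "- {0}"] c op
      by (auto simp: vimage_def intro: continuous_on_diff)
    then show ?thesis
      using False s by (intro exI[of _ "I \<inter> J \<inter> {t. (x t - y t) \<in> - {0}}"]) (auto intro: open_subset)
  qed
qed

lemma ode_solution_glue:
  fixes P :: "'a::euclidean_space \<Rightarrow> 'a"
  assumes P: "C1_on P UNIV" and x: "ode_solution P I x" and y: "ode_solution P J y"
    and a: "a \<in> I \<inter> J" "x a = y a"
  obtains w where "ode_solution P (I \<union> J) w" "\<And>t. t \<in> I \<Longrightarrow> w t = x t" "\<And>t. t \<in> J \<Longrightarrow> w t = y t"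
proof -
  define w where "w t = (if t \<in> I then x t else y t)" for t
  have wx: "w t = x t" if "t \<in> I" for t using that by (simp add: w_def)
  have wy: "w t = y t" if "t \<in> J" for t
    using that ode_solution_unique[OF P x y a] by (auto simp: w_def)
  have op: "open I" "open J" and "connected I" "connected J"
    using x y by (auto simp: ode_solution_def is_interval_connected)
  then have "is_interval (I \<union> J)"
    using a(1) by (auto simp: is_interval_connected_1 intro!: connected_Un)
  moreover have "(w has_vector_derivative P (w t)) (at t)" if "t \<in> I \<union> J" for t
  proof (cases "t \<in> I")
    case True
    then have "(x has_vector_derivative P (x t)) (at t)" using x by (auto simp: ode_solution_def)
    then show ?thesis
      using has_vector_derivative_transform_within_open[OF _ op(1) True] wx True by metis
  next
    case False
    then have t: "t \<in> J" using that by auto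
    then have "(y has_vector_derivative P (y t)) (at t)" using y by (auto simp: ode_solution_def)
    then show ?thesis
      using has_vector_derivative_transform_within_open[OF _ op(2) t] wy t by metis
  qed
  ultimately show ?thesis using that[of w] wx wy op by (auto simp: ode_solution_def)
qed

text \<open>
  Restarting time at \<open>y\<close> makes the time from one point to another additive along orbits, so that arguments about
  orbits become a calculus of travel times.
\<close>

definition reaches :: "('a::real_normed_vector \<Rightarrow> 'a) \<Rightarrow> 'a \<Rightarrow> real \<Rightarrow> 'a \<Rightarrow> bool" where
  "reaches P y s z \<longleftrightarrow> (\<exists>I x. ode_solution P I x \<and> 0 \<in> I \<and> s \<in> I \<and> x 0 = y \<and> x s = z)"

lemma ode_solution_reaches:
  assumes "ode_solution P I x" "s \<in> I" "t \<in> I"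
  shows "reaches P (x s) (t - s) (x t)"
  unfolding reaches_def using ode_solution_shift[OF assms(1), of "-s"] assms
  by (intro exI[of _ "(+) (-s) ` I"] exI[of _ "\<lambda>u. x (u - (- s))"]) (auto simp: image_iff)

lemma reaches_sym: "reaches P y s z \<Longrightarrow> reaches P z (-s) y"
  unfolding reaches_def using ode_solution_reaches[unfolded reaches_def, of P _ _ _ 0]
  by fastforce

lemma reaches_trans:
  fixes P :: "'a::euclidean_space \<Rightarrow> 'a"
  assumes P: "C1_on P UNIV" and "reaches P u s v" "reaches P v t w"
  shows "reaches P u (s + t) w"
proof -
  obtain I x where x: "ode_solution P I x" "0 \<in> I" "s \<in> I" "x 0 = u" "x s = v"
    using assms(2) by (auto simp: reaches_def)
  obtain J y where y: "ode_solution P J y" "0 \<in> J" "t \<in> J" "y 0 = v" "y t = w"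
    using assms(3) by (auto simp: reaches_def)
  have mem: "s \<in> I \<inter> (+) s ` J" "s + t \<in> (+) s ` J" using x y by (auto simp: image_iff)
  have "x s = y (s - s)" using x y by simp
  from ode_solution_glue[OF P x(1) ode_solution_shift[OF y(1)] mem(1) this]
  obtain z where z: "ode_solution P (I \<union> (+) s ` J) z" "\<And>t. t \<in> I \<Longrightarrow> z t = x t"
    "\<And>t. t \<in> (+) s ` J \<Longrightarrow> z t = y (t - s)" by blast
  have "z 0 = u" using z(2)[OF x(2)] x(4) by simp
  moreover have "z (s + t) = w" using z(3)[OF mem(2)] y(5) by simp
  ultimately show ?thesis
    unfolding reaches_def using z(1) x(2) mem(2) by blast
qed

lemma reaches_unique:
  fixes P :: "'a::euclidean_space \<Rightarrow> 'a"
  assumes P: "C1_on P UNIV" and "reaches P y s z" "reaches P y s z'"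
  shows "z = z'"
  using assms(2,3) ode_solution_unique[OF P, of _ _ _ _ 0 s] unfolding reaches_def by (metis IntI)

lemma mem_orbit_domain: "y \<in> orbit_domain P S \<longleftrightarrow> (\<exists>z\<in>S. \<exists>s. reaches P z s y)"
proof
  assume "y \<in> orbit_domain P S"
  then show "\<exists>z\<in>S. \<exists>s. reaches P z s y"
    unfolding orbit_domain_def using ode_solution_reaches by blast
qed (auto simp: orbit_domain_def reaches_def)

lemma local_flow_reaches:
  fixes P :: "'a::euclidean_space \<Rightarrow> 'a"
  assumes P: "C1_on P UNIV"
  obtains e r :: real and \<phi> where "0 < e" "0 < r"
    and "\<And>x. x \<in> ball x0 r \<Longrightarrow> \<phi> 0 x = x"
    and "\<And>t x. t \<in> {-e<..<e} \<Longrightarrow> x \<in> ball x0 r \<Longrightarrow>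
          ((\<lambda>t. \<phi> t x) has_vector_derivative P (\<phi> t x)) (at t)"
    and "\<And>t x. t \<in> {-e<..<e} \<Longrightarrow> x \<in> ball x0 r \<Longrightarrow> reaches P x t (\<phi> t x)"
    and "C1_on (\<lambda>(t, x). \<phi> t x) ({-e<..<e} \<times> ball x0 r)"
proof -
  obtain e r \<phi> where er: "0 < e" "0 < r"
    and \<phi>: "\<And>x. x \<in> ball x0 r \<Longrightarrow> \<phi> 0 x = x"
      "\<And>t x. t \<in> {-e<..<e} \<Longrightarrow> x \<in> ball x0 r \<Longrightarrow>
          ((\<lambda>t. \<phi> t x) has_vector_derivative P (\<phi> t x)) (at t)"
      "C1_on (\<lambda>(t, x). \<phi> t x) ({-e<..<e} \<times> ball x0 r)"
    by (rule local_flow[OF P, of x0]) (rule that)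
  have "reaches P x t (\<phi> t x)" if "t \<in> {-e<..<e}" "x \<in> ball x0 r" for t x
    unfolding reaches_def ode_solution_def using er \<phi>(1)[OF that(2)] \<phi>(2)[OF _ that(2)] that(1)
    by (intro exI[of _ "{-e<..<e}"] exI[of _ "\<lambda>t. \<phi> t x"]) (auto simp: is_interval_oo)
  then show ?thesis by (intro that[of e r \<phi>] er \<phi>)
qed

lemma gradient_eq_along_solution:
  assumes u: "gradient_eq P \<Omega> u g" and x: "ode_solution P I x"
    and sub: "x ` I \<subseteq> \<Omega>" and t: "t \<in> I"
  shows "((\<lambda>t. u (x t)) has_vector_derivative g (x t)) (at t)"
proof -
  have I: "open I" and x': "(x has_vector_derivative P (x t)) (at t)"
    using x t by (auto simp: ode_solution_def)
  obtain D where D: "(u has_derivative D) (at (x t) within \<Omega>)" "D (P (x t)) = g (x t)"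
    using u sub t unfolding gradient_eq_def by blast
  have "((\<lambda>t. u (x t)) has_derivative (\<lambda>h. D (h *\<^sub>R P (x t)))) (at t within I)"
    using x' D(1) sub
    by (intro has_derivative_in_compose[OF _ has_derivative_subset[OF D(1) sub]])
      (auto simp: has_vector_derivative_def intro: has_derivative_at_withinI)
  moreover have "D (h *\<^sub>R P (x t)) = h *\<^sub>R g (x t)" for h
    using linear_cmul[OF has_derivative_linear[OF D(1)]] D(2) by simp
  ultimately show ?thesis
    using at_within_open[OF t I] by (simp add: has_vector_derivative_def)
qed

lemma linear_ode_exp:
  fixes g :: "real \<Rightarrow> complex"
  assumes I: "is_interval I" and g: "\<And>t. t \<in> I \<Longrightarrow> (g has_vector_derivative \<mu> * g t) (at t)"
    and st: "0 \<in> I" "t \<in> I"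
  shows "g t = g 0 * exp (\<mu> * of_real t)"
proof -
  have "((\<lambda>t. g t * exp (- \<mu> * of_real t)) has_vector_derivative 0) (at t within I)" if "t \<in> I" for t
  proof -
    have "((\<lambda>t. exp (- \<mu> * complex_of_real t)) has_vector_derivative - \<mu> * exp (- \<mu> * of_real t)) (at t)"
      by (auto intro!: derivative_eq_intros has_vector_derivative_real_field simp: o_def)
    from has_vector_derivative_mult[OF g[OF that] this]
    show ?thesis by (auto simp: algebra_simps intro: has_vector_derivative_at_within)
  qed
  then obtain c where c: "\<And>t. t \<in> I \<Longrightarrow> g t * exp (- \<mu> * of_real t) = c"
    using has_vector_derivative_zero_constant[of I "\<lambda>t. g t * exp (- \<mu> * of_real t)"] I
    by (auto simp: is_interval_convex)
  have "g t = (g t * exp (- \<mu> * of_real t)) * exp (\<mu> * of_real t)"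
    by (simp add: exp_minus)
  also have "\<dots> = g 0 * exp (\<mu> * of_real t)" using c[OF st(1)] c[OF st(2)] by simp
  finally show ?thesis .
qed

section \<open>Straightening the flow along a hypersurface\<close>

text \<open>
  The cube lies in the hyperplane \<open>u $ p = 0\<close>, which leaves the coordinate \<open>p\<close> free to hold the time. A vector
  \<open>w\<close> thus encodes the pair of the parameter \<open>cube_part p w\<close> and the time \<open>w $ p\<close>, and the straightening map
  becomes a map between open sets of the same space, as the inverse function theorem requires.
\<close>

definition cube_part :: "'n::finite \<Rightarrow> real ^ 'n \<Rightarrow> real ^ 'n" where
  "cube_part p w = w - (w $ p) *\<^sub>R axis p 1"

lemma cube_part_nth [simp]: "cube_part p w $ i = (if i = p then 0 else w $ i)"
  by (simp add: cube_part_def axis_def)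

lemma cube_part_id: "w $ p = 0 \<Longrightarrow> cube_part p w = w"
  by (simp add: cube_part_def)

lemma cube_part_split: "w = (w $ p) *\<^sub>R axis p 1 + cube_part p w"
  by (simp add: cube_part_def)

lemma cube_part_plus [simp]: "cube_part p (w + c *\<^sub>R axis p 1) = cube_part p w"
  by (simp add: vec_eq_iff axis_def)

lemma bounded_linear_cube_part: "bounded_linear (cube_part p)"
  unfolding linear_conv_bounded_linear[symmetric]
  by (rule linearI) (simp_all add: vec_eq_iff)

definition open_cylinder :: "'n::finite \<Rightarrow> (real ^ 'n) set" where
  "open_cylinder p = {w. \<forall>i. i \<noteq> p \<longrightarrow> 0 < w $ i \<and> w $ i < 1}"

lemma open_open_cylinder: "open (open_cylinder p)"
proof -
  have "open_cylinder p = (\<Inter>i\<in>UNIV - {p}. {w. 0 < w $ i} \<inter> {w. w $ i < 1})"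
    by (auto simp: open_cylinder_def)
  then show ?thesis
    by (auto intro!: open_INT open_Int open_Collect_less continuous_intros)
qed

lemma cube_part_in_cube: "cube_part p w \<in> open_cube p \<longleftrightarrow> w \<in> open_cylinder p"
  by (auto simp: open_cube_def open_cylinder_def)

lemma open_cube_cylinder: "u \<in> open_cube p \<longleftrightarrow> u $ p = 0 \<and> u \<in> open_cylinder p"
  by (auto simp: open_cube_def open_cylinder_def)

locale parametrised_section =
  fixes P :: "real ^ 'n \<Rightarrow> real ^ 'n" and S :: "(real ^ 'n) set" and p :: 'n
    and m :: "real ^ 'n \<Rightarrow> real" and \<sigma> \<tau> :: "real ^ 'n \<Rightarrow> real ^ 'n"
    and \<sigma>' :: "real ^ 'n \<Rightarrow> (real ^ 'n) \<Rightarrow>\<^sub>L (real ^ 'n)"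
  assumes P: "C1_on P UNIV"
    and sigma': "\<And>u. u \<in> open_cube p \<Longrightarrow> (\<sigma> has_derivative \<sigma>' u) (at u within open_cube p)"
      "continuous_on (open_cube p) \<sigma>'"
    and immersion: "\<And>u v. u \<in> open_cube p \<Longrightarrow> v $ p = 0 \<Longrightarrow> \<sigma>' u v = 0 \<Longrightarrow> v = 0"
    and homeo: "homeomorphism (open_cube p) S \<sigma> \<tau>"
    and non_recurrent: "non_recurrent P S"
    and unit: "unit_measurement P S m"
begin

abbreviation "\<Omega> \<equiv> orbit_domain P S"

text \<open>
  The coordinates of \<open>y\<close>: the parameter of the point where its orbit crosses \<open>S\<close>, together with the travel time
  from there to \<open>y\<close>.
\<close>

definition chart :: "real ^ 'n \<Rightarrow> real ^ 'n" where
  "chart y = (SOME w. cube_part p w \<in> open_cube p \<and> reaches P (\<sigma> (cube_part p w)) (w $ p) y)"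

lemma sigma_in_S: "u \<in> open_cube p \<Longrightarrow> \<sigma> u \<in> S"
  using homeomorphism_image1[OF homeo] by blast

lemma sigma_C1: "C1_on \<sigma> (open_cube p)"
  using sigma' unfolding C1_on_def by blast

text \<open>
  Two crossings of the same orbit are connected by the difference of their travel times, and non-recurrence forces this
  difference to vanish.
\<close>

lemma crossing_unique:
  assumes "z \<in> S" "z' \<in> S" "reaches P z s y" "reaches P z' s' y"
  shows "z = z' \<and> s = s'"
proof -
  have r: "reaches P z (s - s') z'"
    using reaches_trans[OF P assms(3) reaches_sym[OF assms(4)]] by simp
  then have "0 = s - s'"
    using non_recurrent assms(1,2) unfolding non_recurrent_def reaches_def by metis
  moreover have "z = z'" if "s = s'"
    using r that by (auto simp: reaches_def)
  ultimately show ?thesis by simp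
qed

lemma chart_eqI:
  assumes "cube_part p w \<in> open_cube p" "reaches P (\<sigma> (cube_part p w)) (w $ p) y"
  shows "chart y = w"
proof -
  let ?w = "chart y"
  have w: "cube_part p ?w \<in> open_cube p" "reaches P (\<sigma> (cube_part p ?w)) (?w $ p) y"
    using someI[of "\<lambda>w. cube_part p w \<in> open_cube p \<and> reaches P (\<sigma> (cube_part p w)) (w $ p) y" w] assms
    unfolding chart_def by blast+
  have eq: "\<sigma> (cube_part p ?w) = \<sigma> (cube_part p w)" "?w $ p = w $ p"
    using crossing_unique[OF sigma_in_S[OF w(1)] sigma_in_S[OF assms(1)] w(2) assms(2)] by auto
  have "cube_part p ?w = cube_part p w"
    using homeomorphism_apply1[OF homeo w(1)] homeomorphism_apply1[OF homeo assms(1)] eq(1) by metis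
  then show ?thesis using eq(2) cube_part_split by metis
qed

lemma chart_orbit:
  assumes "y \<in> \<Omega>"
  shows "cube_part p (chart y) \<in> open_cube p"
    and "reaches P (\<sigma> (cube_part p (chart y))) (chart y $ p) y"
proof -
  obtain z s where z: "z \<in> S" "reaches P z s y" using assms by (auto simp: mem_orbit_domain)
  define w where "w = \<tau> z + s *\<^sub>R axis p 1"
  have tau: "\<tau> z \<in> open_cube p" "\<sigma> (\<tau> z) = z"
    using homeomorphism_image2[OF homeo] homeomorphism_apply2[OF homeo] z(1) by auto
  then have "\<tau> z $ p = 0" by (simp add: open_cube_def)
  then have w: "cube_part p w = \<tau> z" "w $ p = s" by (simp_all add: w_def cube_part_id)
  then have "chart y = w" using tau z(2) by (intro chart_eqI) auto
  then show "cube_part p (chart y) \<in> open_cube p"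
      "reaches P (\<sigma> (cube_part p (chart y))) (chart y $ p) y"
    using w tau z(2) by auto
qed

lemma chart_reaches:
  assumes "y \<in> \<Omega>" "reaches P y t y'"
  shows "y' \<in> \<Omega>" and "chart y' = chart y + t *\<^sub>R axis p 1"
proof -
  have r: "reaches P (\<sigma> (cube_part p (chart y))) (chart y $ p + t) y'"
    using reaches_trans[OF P chart_orbit(2)[OF assms(1)] assms(2)] .
  then show "y' \<in> \<Omega>"
    using sigma_in_S[OF chart_orbit(1)[OF assms(1)]] by (auto simp: mem_orbit_domain)
  show "chart y' = chart y + t *\<^sub>R axis p 1"
    using r chart_orbit(1)[OF assms(1)] by (intro chart_eqI) auto
qed

lemma solution_in_domain:
  assumes x: "ode_solution P I x" and s: "s \<in> I" "x s \<in> \<Omega>" and t: "t \<in> I"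
  shows "x t \<in> \<Omega>" and "chart (x t) = chart (x s) + (t - s) *\<^sub>R axis p 1"
  using chart_reaches[OF s(2) ode_solution_reaches[OF x s(1) t]] by auto

text \<open>
  Along a solution \<open>m\<close> increases at unit speed, starting from zero on \<open>S\<close>. Hence \<open>m\<close>, assumed only to be
  differentiable, inherits the \<open>C\<^sup>1\<close> regularity of the chart.
\<close>

lemma m_eq_chart:
  assumes y: "y \<in> \<Omega>"
  shows "m y = chart y $ p"
proof -
  let ?z = "\<sigma> (cube_part p (chart y))"
  have z: "?z \<in> S" using sigma_in_S[OF chart_orbit(1)[OF y]] .
  obtain I x where x: "ode_solution P I x" "0 \<in> I" "chart y $ p \<in> I" "x 0 = ?z" "x (chart y $ p) = y"
    using chart_orbit(2)[OF y] by (auto simp: reaches_def)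
  have sub: "x ` I \<subseteq> \<Omega>" using solution_in_domain(1)[OF x(1,3)] y x(5) by auto
  have I: "convex I" using x(1) by (simp add: ode_solution_def is_interval_convex)
  have "((\<lambda>t. m (x t) - t) has_vector_derivative 0) (at t within I)" if "t \<in> I" for t
  proof -
    have "((\<lambda>t. m (x t)) has_vector_derivative 1) (at t)"
      using gradient_eq_along_solution[OF _ x(1) sub that] unit by (auto simp: unit_measurement_def)
    then have "((\<lambda>t. m (x t) - t) has_vector_derivative 1 - 1) (at t)"
      by (intro has_vector_derivative_diff) (auto intro!: derivative_eq_intros)
    then show ?thesis by (auto intro: has_vector_derivative_at_within)
  qed
  then obtain c where "\<And>t. t \<in> I \<Longrightarrow> m (x t) - t = c"
    using has_vector_derivative_zero_constant[OF I, of "\<lambda>t. m (x t) - t"] by blast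
  from this[OF x(2)] this[OF x(3)] show ?thesis
    using z x(4,5) unit by (simp add: unit_measurement_def)
qed

lemma S_subset_domain: "S \<subseteq> \<Omega>"
proof
  fix z assume z: "z \<in> S"
  obtain e r \<phi> where er: "0 < e" "0 < r"
    and \<phi>: "\<And>x. x \<in> ball z r \<Longrightarrow> \<phi> 0 x = x"
      "\<And>t x. t \<in> {-e<..<e} \<Longrightarrow> x \<in> ball z r \<Longrightarrow>
          ((\<lambda>t. \<phi> t x) has_vector_derivative P (\<phi> t x)) (at t)"
      "\<And>t x. t \<in> {-e<..<e} \<Longrightarrow> x \<in> ball z r \<Longrightarrow> reaches P x t (\<phi> t x)"
      "C1_on (\<lambda>(t, x). \<phi> t x) ({-e<..<e} \<times> ball z r)"
    by (rule local_flow_reaches[OF P, of z]) (rule that)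
  have "reaches P z 0 z" using \<phi>(3)[of 0 z] \<phi>(1)[of z] er by simp
  then show "z \<in> \<Omega>" using z by (auto simp: mem_orbit_domain)
qed

text \<open>
  The derivative of \<open>m\<close> is \<open>1\<close> on \<open>P (\<sigma> u)\<close> and zero on vectors tangent to \<open>S\<close>, because \<open>m\<close>
  vanishes on \<open>S\<close>. Applied to the given relation it yields \<open>c = 0\<close>.
\<close>

lemma transversal:
  assumes u: "u \<in> open_cube p" and v: "v $ p = 0" and eq: "c *\<^sub>R P (\<sigma> u) + \<sigma>' u v = 0"
  shows "c = 0 \<and> v = 0"
proof -
  have z: "\<sigma> u \<in> \<Omega>" using sigma_in_S[OF u] S_subset_domain by blast
  obtain D where D: "(m has_derivative D) (at (\<sigma> u) within \<Omega>)" "D (P (\<sigma> u)) = 1"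
    using unit z unfolding unit_measurement_def gradient_eq_def by blast
  \<comment> \<open>The cube has empty interior, so derivatives within it need not be unique. They are compared along the
    line through \<open>u\<close> in direction \<open>v\<close>, which stays in the cube for the open set \<open>T\<close> of times.\<close>
  define T where "T = (\<lambda>s::real. u + s *\<^sub>R v) -` open_cylinder p"
  have T: "open T" "0 \<in> T"
    unfolding T_def using u
    by (auto intro!: open_vimage open_open_cylinder continuous_intros simp: open_cube_cylinder)
  have curve: "(\<lambda>s. u + s *\<^sub>R v) ` T \<subseteq> open_cube p"
    using u v by (auto simp: T_def open_cube_cylinder)
  have "((\<lambda>s::real. u + s *\<^sub>R v) has_derivative (\<lambda>s. s *\<^sub>R v)) (at 0 within T)"
    by (auto intro!: derivative_eq_intros)
  from has_derivative_in_compose[OF this, of \<sigma> "\<sigma>' u"]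
  have "((\<lambda>s. \<sigma> (u + s *\<^sub>R v)) has_derivative (\<lambda>s. \<sigma>' u (s *\<^sub>R v))) (at 0 within T)"
    using has_derivative_subset[OF sigma'(1)[OF u] curve] by simp
  from has_derivative_in_compose[OF this, of m D]
  have "((\<lambda>s. m (\<sigma> (u + s *\<^sub>R v))) has_derivative (\<lambda>s. D (\<sigma>' u (s *\<^sub>R v)))) (at 0 within T)"
    using has_derivative_subset[OF D(1), of "(\<lambda>s. \<sigma> (u + s *\<^sub>R v)) ` T"] curve sigma_in_S S_subset_domain
    by force
  moreover have "m (\<sigma> (u + s *\<^sub>R v)) = 0" if "s \<in> T" for s
    using sigma_in_S curve that unit unfolding unit_measurement_def by blast
  ultimately have "((\<lambda>s. 0) has_derivative (\<lambda>s. D (\<sigma>' u (s *\<^sub>R v)))) (at 0 within T)"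
    using has_derivative_transform[OF T(2), of "\<lambda>_. 0"] by metis
  then have "(\<lambda>s::real. D (\<sigma>' u (s *\<^sub>R v))) = (\<lambda>s. 0)"
    using T has_derivative_unique[OF _ has_derivative_const] by (metis at_within_open)
  from fun_cong[OF this, of 1] have Dv: "D (\<sigma>' u v) = 0" by simp
  have lin: "linear D" using D(1) by (rule has_derivative_linear)
  have "D (c *\<^sub>R P (\<sigma> u) + \<sigma>' u v) = c"
    using Dv D(2) by (simp add: linear_add[OF lin] linear_cmul[OF lin])
  then have c: "c = 0" using eq linear_0[OF lin] by simp
  with eq immersion[OF u v] show ?thesis by simp
qed

text \<open>
  The property that spreads from \<open>S\<close> along orbits. It includes that \<open>y\<close> is interior to \<open>\<Omega>\<close>.
\<close>

definition straightened :: "real ^ 'n \<Rightarrow> bool" where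
  "straightened y \<longleftrightarrow> (\<exists>U. open U \<and> y \<in> U \<and> U \<subseteq> \<Omega> \<and> C1_on chart U)"

text \<open>
  Near \<open>u\<close> the map \<open>G w = \<phi> (w $ p) (\<sigma> (cube_part p w))\<close> is a \<open>C\<^sup>1\<close> right inverse of the chart. Its
  derivative at \<open>u\<close> sends \<open>v\<close> to \<open>(v $ p) *\<^sub>R P (\<sigma> u) + \<sigma>' u (cube_part p v)\<close>, which
  \<open>transversal\<close> shows to be injective, so the local inverse of \<open>G\<close> is the chart.
\<close>

lemma straightened_section:
  assumes u: "u \<in> open_cube p"
  shows "straightened (\<sigma> u)"
proof -
  obtain e r \<phi> where er: "0 < e" "0 < r"
    and \<phi>: "\<And>x. x \<in> ball (\<sigma> u) r \<Longrightarrow> \<phi> 0 x = x"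
      "\<And>t x. t \<in> {-e<..<e} \<Longrightarrow> x \<in> ball (\<sigma> u) r \<Longrightarrow>
          ((\<lambda>t. \<phi> t x) has_vector_derivative P (\<phi> t x)) (at t)"
      "\<And>t x. t \<in> {-e<..<e} \<Longrightarrow> x \<in> ball (\<sigma> u) r \<Longrightarrow> reaches P x t (\<phi> t x)"
      "C1_on (\<lambda>(t, x). \<phi> t x) ({-e<..<e} \<times> ball (\<sigma> u) r)"
    by (rule local_flow_reaches[OF P, of "\<sigma> u"]) (rule that)
  have up: "u $ p = 0" "cube_part p u = u" using u by (auto simp: open_cube_def cube_part_id)
  define O' where "O' = open_cylinder p \<inter> {w. w $ p \<in> {-e<..<e}}"
  define W where "W = O' \<inter> (\<lambda>w. \<sigma> (cube_part p w)) -` ball (\<sigma> u) r"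
  define G where "G = (\<lambda>w. \<phi> (w $ p) (\<sigma> (cube_part p w)))"
  have O': "open O'"
    unfolding O'_def by (auto intro!: open_Int open_open_cylinder open_Collect_less open_Collect_conj continuous_intros)
  have base: "C1_on (\<lambda>w. \<sigma> (cube_part p w)) O'"
    using C1_on_compose[OF C1_on_affine[OF bounded_linear_cube_part[of p], where c = 0 and A = O'] sigma_C1]
    by (simp add: image_subset_iff cube_part_in_cube O'_def)
  have W: "open W" unfolding W_def
    by (rule continuous_open_preimage[OF C1_on_imp_continuous_on[OF base] O' open_ball])
  have uW: "u \<in> W" using u up er by (auto simp: W_def O'_def open_cube_cylinder)
  have "C1_on (\<lambda>w. (w $ p, \<sigma> (cube_part p w))) W"
    using C1_on_affine[OF bounded_linear_vec_nth, of 0 p W]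
    by (intro C1_on_Pair C1_on_subset[OF base]) (auto simp: W_def)
  then have GC1: "C1_on G W"
    unfolding G_def using C1_on_compose[OF _ \<phi>(4)] by (fastforce simp: W_def O'_def)
  then obtain G0 where G0: "(G has_derivative G0) (at u)"
    using uW W unfolding C1_on_def by (metis at_within_open)
  have lin: "linear G0" using G0 by (rule has_derivative_linear)
  have along: "((\<lambda>s. G (u + s *\<^sub>R v)) has_derivative (\<lambda>s. s *\<^sub>R G0 v)) (at 0)" for v
  proof -
    have "((\<lambda>s::real. u + s *\<^sub>R v) has_derivative (\<lambda>s. s *\<^sub>R v)) (at 0)"
      by (auto intro!: derivative_eq_intros)
    from has_derivative_compose[OF this, of G G0] G0 show ?thesis
      by (simp add: linear_cmul[OF lin])
  qed
  \<comment> \<open>Varying the coordinate \<open>p\<close> at \<open>u\<close> follows the solution through \<open>\<sigma> u\<close>; varying the others at time zero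
    moves along \<open>S\<close>.\<close>
  have "G0 (axis p 1) = P (\<sigma> u)"
  proof -
    have "(\<lambda>s. G (u + s *\<^sub>R axis p 1)) = (\<lambda>s. \<phi> s (\<sigma> u))"
      by (simp add: G_def up fun_eq_iff)
    then have "((\<lambda>s. \<phi> s (\<sigma> u)) has_vector_derivative G0 (axis p 1)) (at 0)"
      using along[of "axis p 1"] by (simp add: has_vector_derivative_def)
    then show ?thesis
      using \<phi>(2)[of 0 "\<sigma> u"] \<phi>(1)[of "\<sigma> u"] er vector_derivative_unique_at by fastforce
  qed
  moreover have "G0 v = \<sigma>' u v" if v: "v $ p = 0" for v
  proof -
    define T where "T = (\<lambda>s::real. u + s *\<^sub>R v) -` W"
    have T: "open T" "0 \<in> T"
      unfolding T_def using uW by (auto intro!: open_vimage W continuous_intros)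
    have cube: "u + s *\<^sub>R v \<in> open_cube p" if "s \<in> T" for s
      using that u v by (auto simp: T_def W_def O'_def open_cube_cylinder)
    have "G (u + s *\<^sub>R v) = \<sigma> (u + s *\<^sub>R v)" if "s \<in> T" for s
    proof -
      have "cube_part p (u + s *\<^sub>R v) = u + s *\<^sub>R v" using up v by (simp add: cube_part_id)
      then show ?thesis using that \<phi>(1) up v by (auto simp: T_def W_def G_def)
    qed
    then have 1: "((\<lambda>s. \<sigma> (u + s *\<^sub>R v)) has_derivative (\<lambda>s. s *\<^sub>R G0 v)) (at 0)"
      using has_derivative_transform_within_open[OF along T] by auto
    have "((\<lambda>s::real. u + s *\<^sub>R v) has_derivative (\<lambda>s. s *\<^sub>R v)) (at 0 within T)"
      by (auto intro!: derivative_eq_intros)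
    from has_derivative_in_compose[OF this, of \<sigma> "\<sigma>' u"]
    have "((\<lambda>s. \<sigma> (u + s *\<^sub>R v)) has_derivative (\<lambda>s. \<sigma>' u (s *\<^sub>R v))) (at 0 within T)"
      using has_derivative_subset[OF sigma'(1)[OF u], of "(\<lambda>s. u + s *\<^sub>R v) ` T"] cube by auto
    then have "((\<lambda>s. \<sigma> (u + s *\<^sub>R v)) has_derivative (\<lambda>s. \<sigma>' u (s *\<^sub>R v))) (at 0)"
      using at_within_open[OF T(2,1)] by simp
    from fun_cong[OF has_derivative_unique[OF 1 this], of 1] show ?thesis by simp
  qed
  ultimately have G0_eq: "G0 v = (v $ p) *\<^sub>R P (\<sigma> u) + \<sigma>' u (cube_part p v)" for v
    using linear_add[OF lin] linear_cmul[OF lin] cube_part_split[of v p] by (metis cube_part_nth)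
  have "v = 0" if "G0 v = 0" for v
    using transversal[OF u, of "cube_part p v" "v $ p"] that cube_part_split[of v p] by (simp add: G0_eq)
  from C1_local_inverse[OF W GC1 uW G0 this] obtain V g where
    V: "open V" "G u \<in> V" "C1_on g V" "\<And>y. y \<in> V \<Longrightarrow> g y \<in> W \<and> G (g y) = y" by metis
  have "G u = \<sigma> u" using up \<phi>(1) er by (simp add: G_def)
  moreover have chart_g: "chart y = g y" "y \<in> \<Omega>" if y: "y \<in> V" for y
  proof -
    have w: "g y $ p \<in> {-e<..<e}" "\<sigma> (cube_part p (g y)) \<in> ball (\<sigma> u) r" "cube_part p (g y) \<in> open_cube p"
      using V(4)[OF y] by (auto simp: W_def O'_def cube_part_in_cube)
    have "reaches P (\<sigma> (cube_part p (g y))) (g y $ p) y"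
      using \<phi>(3)[OF w(1,2)] V(4)[OF y] by (simp add: G_def)
    then show "chart y = g y" "y \<in> \<Omega>"
      using w(3) sigma_in_S[OF w(3)] by (auto intro: chart_eqI simp: mem_orbit_domain)
  qed
  ultimately show ?thesis
    unfolding straightened_def using V C1_on_cong[OF V(3), of chart] by (intro exI[of _ V]) auto
qed

text \<open>
  If \<open>s\<close> is a short time, then \<open>chart z = chart (\<phi> s z) - s *\<^sub>R axis p 1\<close>, so \<open>C\<^sup>1\<close> regularity of the
  chart near \<open>\<phi> s z\<close> pulls back to a neighbourhood of \<open>z\<close>. Because the local flow exists for a uniform time around
  each point of the orbit, nearby points of the orbit are straightened together, and the time interval is connected.
\<close>

lemma straightened_reaches:
  assumes y: "straightened y" and r: "reaches P y t y'"
  shows "straightened y'"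
proof -
  obtain I x where x: "ode_solution P I x" "0 \<in> I" "t \<in> I" "x 0 = y" "x t = y'"
    using r by (auto simp: reaches_def)
  have I: "open I" "connected I" using x(1) by (auto simp: ode_solution_def is_interval_connected)
  have "straightened (x t)"
  proof (rule connected_induction_simple[where P = "\<lambda>t. straightened (x t)", OF I(2) x(2,3)])
    show "straightened (x 0)" using y x(4) by simp
    fix a assume a: "a \<in> I"
    obtain e r \<phi> where er: "0 < e" "0 < r"
      and \<phi>: "\<And>z. z \<in> ball (x a) r \<Longrightarrow> \<phi> 0 z = z"
        "\<And>t z. t \<in> {-e<..<e} \<Longrightarrow> z \<in> ball (x a) r \<Longrightarrow>
            ((\<lambda>t. \<phi> t z) has_vector_derivative P (\<phi> t z)) (at t)"
        "\<And>t z. t \<in> {-e<..<e} \<Longrightarrow> z \<in> ball (x a) r \<Longrightarrow> reaches P z t (\<phi> t z)"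
        "C1_on (\<lambda>(t, z). \<phi> t z) ({-e<..<e} \<times> ball (x a) r)"
      by (rule local_flow_reaches[OF P, of "x a"]) (rule that)
    define T where "T = (I \<inter> x -` ball (x a) r) \<inter> ball a (e/2)"
    have T: "open T" "a \<in> T"
      using a er continuous_open_preimage[OF ode_solution_continuous[OF x(1)] I(1) open_ball]
      by (auto simp: T_def)
    have "straightened (x v)" if uv: "u \<in> T" "v \<in> T" and str: "straightened (x u)" for u v
    proof -
      let ?s = "u - v"
      have "\<bar>a - u\<bar> < e/2" "\<bar>a - v\<bar> < e/2" using uv by (auto simp: T_def dist_real_def)
      then have "\<bar>?s\<bar> < e" by linarith
      then have s: "?s \<in> {-e<..<e}" by auto
      have xv: "x v \<in> ball (x a) r" "u \<in> I" "v \<in> I" using uv by (auto simp: T_def)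
      have hit: "\<phi> ?s (x v) = x u"
        using reaches_unique[OF P \<phi>(3)[OF s xv(1)] ode_solution_reaches[OF x(1) xv(3,2)]] .
      obtain U where U: "open U" "x u \<in> U" "U \<subseteq> \<Omega>" "C1_on chart U"
        using str by (auto simp: straightened_def)
      have slice: "C1_on (\<lambda>z. (?s, z)) (ball (x a) r)"
        using C1_on_affine[of "\<lambda>z. (0, z)" "(?s, 0)" "ball (x a) r"]
        by (simp add: bounded_linear_Pair bounded_linear_ident bounded_linear_zero)
      have \<phi>s: "C1_on (\<phi> ?s) (ball (x a) r)"
        using C1_on_compose[OF slice \<phi>(4)] s by (simp add: image_subset_iff)
      define U' where "U' = ball (x a) r \<inter> \<phi> ?s -` U"
      have "open U'" unfolding U'_def
        by (rule continuous_open_preimage[OF C1_on_imp_continuous_on[OF \<phi>s] open_ball U(1)])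
      moreover have "x v \<in> U'" using xv hit U by (auto simp: U'_def)
      moreover have pullback: "z \<in> \<Omega>" "chart z = - ?s *\<^sub>R axis p 1 + chart (\<phi> ?s z)" if "z \<in> U'" for z
      proof -
        have "reaches P (\<phi> ?s z) (- ?s) z" using reaches_sym[OF \<phi>(3)[OF s]] that by (auto simp: U'_def)
        moreover have "\<phi> ?s z \<in> \<Omega>" using that U by (auto simp: U'_def)
        ultimately show "z \<in> \<Omega>" "chart z = - ?s *\<^sub>R axis p 1 + chart (\<phi> ?s z)"
          using chart_reaches by (auto simp: algebra_simps)
      qed
      moreover have "C1_on chart U'"
      proof (rule C1_on_cong)
        have "C1_on (\<lambda>z. chart (\<phi> ?s z)) U'"
          by (rule C1_on_compose[OF C1_on_subset[OF \<phi>s] U(4)]) (auto simp: U'_def)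
        from C1_on_compose[OF this C1_on_affine[OF bounded_linear_ident] subset_UNIV]
        show "C1_on (\<lambda>z. - ?s *\<^sub>R axis p 1 + chart (\<phi> ?s z)) U'" .
      qed (rule pullback(2))
      ultimately show ?thesis
        unfolding straightened_def by (intro exI[of _ U'] conjI subsetI)
    qed
    moreover have "openin (top_of_set I) T" by (rule open_subset[OF _ T(1)]) (auto simp: T_def)
    ultimately show "\<exists>T. openin (top_of_set I) T \<and> a \<in> T \<and> (\<forall>u\<in>T. \<forall>v\<in>T. straightened (x u) \<longrightarrow> straightened (x v))"
      using T(2) by (intro exI[of _ T] conjI ballI impI)
  qed
  then show ?thesis using x(5) by simp
qed

lemma straightened_domain: "y \<in> \<Omega> \<Longrightarrow> straightened y"
  using straightened_reaches[OF straightened_section chart_orbit(2)] chart_orbit(1) by blast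

lemma open_domain: "open \<Omega>"
  using straightened_domain unfolding straightened_def by (subst open_subopen) blast

lemma chart_C1: "C1_on chart \<Omega>"
  using straightened_domain unfolding straightened_def by (intro C1_on_locally) blast

lemma cube_part_chart_C1: "C1_on (\<lambda>x. cube_part p (chart x)) \<Omega>"
  using C1_on_compose[OF chart_C1 C1_on_affine[OF bounded_linear_cube_part, of 0] subset_UNIV] by simp

text \<open>
  Along a solution through \<open>y\<close> the chart is affine in time, and its velocity there is the derivative of the
  chart applied to \<open>P y\<close>.
\<close>

lemma gradient_chart: "gradient_eq P \<Omega> chart (\<lambda>_. axis p 1)"
  unfolding gradient_eq_def
proof
  fix y assume y: "y \<in> \<Omega>"
  obtain D where D: "(chart has_derivative D) (at y)"
    using chart_C1 y at_within_open[OF y open_domain] unfolding C1_on_def by metis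
  obtain I x where x: "ode_solution P I x" "chart y $ p \<in> I" "x (chart y $ p) = y"
    using chart_orbit(2)[OF y] by (auto simp: reaches_def)
  let ?t = "chart y $ p"
  have I: "open I" and x': "(x has_vector_derivative P y) (at ?t)"
    using x by (auto simp: ode_solution_def)
  have "((\<lambda>t. chart (x t)) has_vector_derivative D (P y)) (at ?t)"
    using has_derivative_compose[of x "\<lambda>h. h *\<^sub>R P y" ?t UNIV chart D] x' D x(3)
    by (simp add: has_vector_derivative_def linear_cmul[OF has_derivative_linear[OF D]])
  then have "((\<lambda>t. chart y + (t - ?t) *\<^sub>R axis p 1) has_vector_derivative D (P y)) (at ?t)"
    by (rule has_vector_derivative_transform_within_open[OF _ I x(2)])
      (use solution_in_domain(2)[OF x(1,2)] x(3) y in auto)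
  moreover have "((\<lambda>t. chart y + (t - ?t) *\<^sub>R axis p 1) has_vector_derivative axis p 1) (at ?t)"
    by (auto simp: has_vector_derivative_def intro!: derivative_eq_intros)
  ultimately have "D (P y) = axis p 1"
    by (rule vector_derivative_unique_at)
  then show "\<exists>D. (chart has_derivative D) (at y within \<Omega>) \<and> D (P y) = axis p 1"
    using D has_derivative_at_withinI by blast
qed

section \<open>Invariant functions and Koopman eigenfunctions\<close>

lemma invariant_chart_nth:
  assumes "i \<noteq> p"
  shows "invariant_function P \<Omega> (\<lambda>x. chart x $ i)"
  unfolding invariant_function_def gradient_eq_def
proof
  fix y assume "y \<in> \<Omega>"
  then obtain D where D: "(chart has_derivative D) (at y within \<Omega>)" "D (P y) = axis p 1"
    using gradient_chart by (auto simp: gradient_eq_def)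
  have "((\<lambda>x. chart x $ i) has_derivative (\<lambda>h. D h $ i)) (at y within \<Omega>)"
    by (rule bounded_linear.has_derivative[OF bounded_linear_vec_nth D(1)])
  moreover have "D (P y) $ i = 0" using D(2) assms by (simp add: axis_def)
  ultimately show "\<exists>D. ((\<lambda>x. chart x $ i) has_derivative D) (at y within \<Omega>) \<and> D (P y) = 0" by blast
qed

lemma gradient_product:
  fixes f :: "real ^ 'n \<Rightarrow> complex"
  assumes f: "f differentiable_on open_cube p"
  shows "gradient_eq P \<Omega> (\<lambda>x. f (cube_part p (chart x)) * exp (\<mu> * complex_of_real (m x)))
    (\<lambda>x. \<mu> * (f (cube_part p (chart x)) * exp (\<mu> * complex_of_real (m x))))"
  unfolding gradient_eq_def
proof
  fix y assume y: "y \<in> \<Omega>"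
  let ?b = "\<lambda>x. cube_part p (chart x)"
  obtain D where D: "(chart has_derivative D) (at y within \<Omega>)" "D (P y) = axis p 1"
    using gradient_chart y by (auto simp: gradient_eq_def)
  obtain M where M: "(m has_derivative M) (at y within \<Omega>)" "M (P y) = 1"
    using unit y by (auto simp: unit_measurement_def gradient_eq_def)
  obtain F where F: "(f has_derivative F) (at (?b y) within open_cube p)"
    using f chart_orbit(1)[OF y] unfolding differentiable_on_def differentiable_def by blast
  have sub: "?b ` \<Omega> \<subseteq> open_cube p" using chart_orbit(1) by blast
  have "(?b has_derivative (\<lambda>h. cube_part p (D h))) (at y within \<Omega>)"
    by (rule bounded_linear.has_derivative[OF bounded_linear_cube_part D(1)])
  from has_derivative_in_compose[OF this has_derivative_subset[OF F sub]]
  have fb: "((\<lambda>x. f (?b x)) has_derivative (\<lambda>h. F (cube_part p (D h)))) (at y within \<Omega>)" .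
  have "((\<lambda>x. \<mu> * complex_of_real (m x)) has_derivative (\<lambda>h. \<mu> * complex_of_real (M h))) (at y within \<Omega>)"
    by (intro has_derivative_mult_right bounded_linear.has_derivative[OF bounded_linear_of_real] M)
  from has_derivative_compose[OF this DERIV_exp[unfolded has_field_derivative_def]]
  have "((\<lambda>x. exp (\<mu> * complex_of_real (m x))) has_derivative
      (\<lambda>h. exp (\<mu> * complex_of_real (m y)) * (\<mu> * complex_of_real (M h)))) (at y within \<Omega>)" .
  note K = has_derivative_mult[OF fb this]
  have "cube_part p (axis p 1) = (0 :: real ^ 'n)" by (simp add: cube_part_def)
  then have "f (?b y) * (exp (\<mu> * complex_of_real (m y)) * (\<mu> * complex_of_real (M (P y))))
      + F (cube_part p (D (P y))) * exp (\<mu> * complex_of_real (m y))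
      = \<mu> * (f (?b y) * exp (\<mu> * complex_of_real (m y)))"
    using D(2) M(2) linear_0[OF has_derivative_linear[OF F]] by simp
  with K show "\<exists>D. ((\<lambda>x. f (?b x) * exp (\<mu> * complex_of_real (m x))) has_derivative D) (at y within \<Omega>) \<and>
      D (P y) = \<mu> * (f (?b y) * exp (\<mu> * complex_of_real (m y)))"
    by (intro exI conjI)
qed

lemma eigenfunction_product:
  assumes \<Phi>: "koopman_eigenfunction P \<Omega> \<mu> \<Phi>" and y: "y \<in> \<Omega>"
  shows "\<Phi> y = \<Phi> (\<sigma> (cube_part p (chart y))) * exp (\<mu> * complex_of_real (m y))"
proof -
  let ?t = "chart y $ p"
  obtain I x where x: "ode_solution P I x" "0 \<in> I" "?t \<in> I" "x 0 = \<sigma> (cube_part p (chart y))" "x ?t = y"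
    using chart_orbit(2)[OF y] by (auto simp: reaches_def)
  have sub: "x ` I \<subseteq> \<Omega>" using solution_in_domain(1)[OF x(1,3)] y x(5) by auto
  have "\<Phi> (x ?t) = \<Phi> (x 0) * exp (\<mu> * complex_of_real ?t)"
    by (rule linear_ode_exp[OF _ gradient_eq_along_solution[OF _ x(1) sub] x(2,3)])
      (use \<Phi> x(1) in \<open>auto simp: koopman_eigenfunction_def ode_solution_def\<close>)
  then show ?thesis using x(4,5) m_eq_chart[OF y] by simp
qed

lemma product_eigenfunction:
  assumes f: "C1_on f (open_cube p)"
    and eq: "\<And>x. x \<in> \<Omega> \<Longrightarrow> \<Phi> x = f (cube_part p (chart x)) * exp (\<mu> * complex_of_real (m x))"
  shows "koopman_eigenfunction P \<Omega> \<mu> \<Phi>"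
proof -
  have "C1_on (\<lambda>x. f (cube_part p (chart x))) \<Omega>"
    using C1_on_compose[OF cube_part_chart_C1 f] chart_orbit(1) by blast
  moreover have "C1_on (\<lambda>x. exp (\<mu> * complex_of_real (m x))) \<Omega>"
  proof (rule C1_on_cong)
    have "bounded_linear (\<lambda>w::real ^ 'n. \<mu> * complex_of_real (w $ p))"
      by (intro bounded_linear_const_mult bounded_linear_compose[OF bounded_linear_of_real] bounded_linear_vec_nth)
    from C1_on_compose[OF C1_on_compose[OF chart_C1 C1_on_affine[OF this, of 0] subset_UNIV] C1_on_exp subset_UNIV]
    show "C1_on (\<lambda>x. exp (\<mu> * complex_of_real (chart x $ p))) \<Omega>" by simp
  qed (simp add: m_eq_chart)
  ultimately have "C1_on \<Phi> \<Omega>"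
    using C1_on_cong[OF C1_on_mult] eq by blast
  moreover have "gradient_eq P \<Omega> \<Phi> (\<lambda>x. \<mu> * \<Phi> x)"
  proof -
    have "f differentiable_on open_cube p"
      using f unfolding C1_on_def differentiable_on_def differentiable_def by blast
    note grad = gradient_product[OF this, of \<mu>]
    show ?thesis unfolding gradient_eq_def
    proof
      fix y assume y: "y \<in> \<Omega>"
      then obtain D where D: "((\<lambda>x. f (cube_part p (chart x)) * exp (\<mu> * complex_of_real (m x))) has_derivative D)
          (at y within \<Omega>)" "D (P y) = \<mu> * \<Phi> y"
        using grad eq unfolding gradient_eq_def by fastforce
      from has_derivative_transform[OF y eq D(1)] D(2)
      show "\<exists>D. (\<Phi> has_derivative D) (at y within \<Omega>) \<and> D (P y) = \<mu> * \<Phi> y" by blast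
    qed
  qed
  ultimately show ?thesis by (simp add: koopman_eigenfunction_def)
qed

end

theorem theorem3p4:
  fixes P :: "real ^ 'n \<Rightarrow> real ^ 'n"
    and S :: "(real ^ 'n) set"
    and m :: "real ^ 'n \<Rightarrow> real"
    and p :: 'n
  assumes "C1_on P UNIV"
    and "embedded_open_hypersurface p S"
    and "non_recurrent P S"
    and "unit_measurement P S m"
  shows "\<exists>h :: 'n \<Rightarrow> real ^ 'n \<Rightarrow> real.
    (\<forall>i. i \<noteq> p \<longrightarrow>
       (\<forall>x\<in>orbit_domain P S. 0 < h i x \<and> h i x < 1) \<and>
       invariant_function P (orbit_domain P S) (h i)) \<and>
    (\<forall>\<mu> \<Phi>. koopman_eigenfunction P (orbit_domain P S) \<mu> \<Phi> \<longleftrightarrow>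
       (\<exists>f :: real ^ 'n \<Rightarrow> complex. C1_on f (open_cube p) \<and>
          (\<forall>x\<in>orbit_domain P S. \<Phi> x = f (tuple_at p h x) * exp (\<mu> * complex_of_real (m x))))) \<and>
    (\<forall>\<mu> (f :: real ^ 'n \<Rightarrow> complex). f differentiable_on open_cube p \<longrightarrow>
       gradient_eq P (orbit_domain P S)
         (\<lambda>x. f (tuple_at p h x) * exp (\<mu> * complex_of_real (m x)))
         (\<lambda>x. \<mu> * (f (tuple_at p h x) * exp (\<mu> * complex_of_real (m x)))))"
proof -
  from assms(2) obtain \<sigma> \<sigma>' \<tau> where sigma:
    "\<forall>u\<in>open_cube p. (\<sigma> has_derivative blinfun_apply (\<sigma>' u)) (at u within open_cube p) \<and>
       (\<forall>v. v $ p = 0 \<and> blinfun_apply (\<sigma>' u) v = 0 \<longrightarrow> v = 0)"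
    "continuous_on (open_cube p) \<sigma>'" "homeomorphism (open_cube p) S \<sigma> \<tau>"
    unfolding embedded_open_hypersurface_def by (elim exE conjE)
  interpret parametrised_section P S p m \<sigma> \<tau> \<sigma>'
    by unfold_locales (use sigma assms in auto)
  define h where "h i x = chart x $ i" for i x
  have tuple: "tuple_at p h x = cube_part p (chart x)" for x
    by (simp add: tuple_at_def h_def vec_eq_iff)
  have "0 < h i x \<and> h i x < 1" if "i \<noteq> p" "x \<in> \<Omega>" for i x
    using chart_orbit(1)[OF that(2)] that(1) by (auto simp: open_cube_def h_def)
  moreover have "invariant_function P \<Omega> (h i)" if "i \<noteq> p" for i
    using invariant_chart_nth[OF that] by (simp add: h_def[abs_def])
  moreover have "koopman_eigenfunction P \<Omega> \<mu> \<Phi> \<longleftrightarrow>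
       (\<exists>f :: real ^ 'n \<Rightarrow> complex. C1_on f (open_cube p) \<and>
          (\<forall>x\<in>\<Omega>. \<Phi> x = f (tuple_at p h x) * exp (\<mu> * complex_of_real (m x))))" for \<mu> \<Phi>
  proof
    assume \<Phi>: "koopman_eigenfunction P \<Omega> \<mu> \<Phi>"
    then have "C1_on (\<lambda>u. \<Phi> (\<sigma> u)) (open_cube p)"
      using sigma_in_S S_subset_domain
      by (intro C1_on_compose[OF sigma_C1]) (auto simp: koopman_eigenfunction_def)
    then show "\<exists>f :: real ^ 'n \<Rightarrow> complex. C1_on f (open_cube p) \<and>
          (\<forall>x\<in>\<Omega>. \<Phi> x = f (tuple_at p h x) * exp (\<mu> * complex_of_real (m x)))"
      using eigenfunction_product[OF \<Phi>] unfolding tuple by blast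
  qed (auto simp: tuple intro: product_eigenfunction)
  ultimately show ?thesis
    using gradient_product unfolding tuple[symmetric] by (intro exI[of _ h]) blast
qed

end
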